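(* There is an absolute constant $C>0$ such that the following holds. Let $n=n(d)\ge d+1$ be integers with $\frac{n-d}{d}\to0$ as $d\to\infty$. Then there are real numbers $R_d$ and $\varepsilon_d$ with $|R_d|\le C\,\frac{(n-d)^3}{d^2}$ and $\varepsilon_d\to0$ as $d\to\infty$ such that, for all sufficiently large $d$, $$ \mathbb{E} f_{d-1}(P^{(d)}_n) = \binom{n}{d}\,2^{-(n-d)+1}\,\exp\left(\frac1\pi\,\frac{(n-d)^2}{d}+R_d+\varepsilon_d\right). $$
   Context: For integers $n,d\ge1$, the Gaussian polytope $P^{(d)}_n=[X_1,\dots,X_n]$ is the convex hull of $n$ independent standard Gaussian random points $X_1,\dots,X_n$ in $\mathbb{R}^d$. For a polytope $Q$, $f_{i}(Q)$ denotes the number of $i$-dimensional faces of $Q$; thus $f_{d-1}(P^{(d)}_n)$ is its number of facets. *)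

theory Defs
  imports "HOL-Probability.Probability" "HOL-Analysis.Finite_Function_Topology"
begin

text \<open>
  Since the dimension \<open>d\<close> tends to infinity inside the statement, it cannot be a type. All the spaces
  \<open>\<real>\<^sup>d\<close> are therefore taken inside the real vector space \<open>nat \<Rightarrow>\<^sub>0 real\<close> of finitely supported
  sequences, \<open>\<real>\<^sup>d\<close> being the span of the first \<open>d\<close> unit vectors \<open>Poly_Mapping.single k 1\<close>, \<open>k < d\<close>.
  Convex hulls and faces (\<open>convex hull\<close>, \<open>face_of\<close>) are available in every real vector space.
\<close>

text \<open>
  The library's \<open>aff_dim\<close> is restricted to Euclidean spaces; this is its definition word for
  word, for an arbitrary real vector space.
\<close>

definition affine_dim :: "'a::real_vector set \<Rightarrow> int" where
  "affine_dim V =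
    (SOME d. \<exists>B. affine hull B = affine hull V \<and> \<not> affine_dependent B \<and> of_nat (card B) = d + 1)"

lemma affine_dim_eq_aff_dim: "affine_dim V = aff_dim V"
  by (simp add: affine_dim_def aff_dim_def)

definition num_faces :: "nat \<Rightarrow> 'a::real_vector set \<Rightarrow> nat" where
  "num_faces i Q = card {F. F face_of Q \<and> affine_dim F = int i}"

text \<open>
  An outcome \<open>\<omega>\<close> is an array of independent standard normal variables,
  \<open>\<omega> (i, k)\<close> being the \<open>k\<close>-th coordinate of the \<open>i\<close>-th point.
\<close>

definition gaussian_array :: "nat \<Rightarrow> nat \<Rightarrow> (nat \<times> nat \<Rightarrow> real) measure" where
  "gaussian_array n d = (\<Pi>\<^sub>M p\<in>{..<n} \<times> {..<d}. density lborel (\<lambda>x. ennreal (std_normal_density x)))"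

definition gaussian_point :: "nat \<Rightarrow> (nat \<times> nat \<Rightarrow> real) \<Rightarrow> nat \<Rightarrow> (nat \<Rightarrow>\<^sub>0 real)" where
  "gaussian_point d \<omega> i = (\<Sum>k<d. Poly_Mapping.single k (\<omega> (i, k)))"

definition gaussian_polytope :: "nat \<Rightarrow> nat \<Rightarrow> (nat \<times> nat \<Rightarrow> real) \<Rightarrow> (nat \<Rightarrow>\<^sub>0 real) set" where
  "gaussian_polytope n d \<omega> = convex hull (gaussian_point d \<omega> ` {..<n})"

definition expected_num_faces :: "nat \<Rightarrow> nat \<Rightarrow> nat \<Rightarrow> real" where
  "expected_num_faces i n d =
    (\<integral>\<omega>. real (num_faces i (gaussian_polytope n d \<omega>)) \<partial>gaussian_array n d)"

end

theory Submission
  imports Defs "HOL-Real_Asymp.Real_Asymp"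
begin

text \<open>
  Let \<open>m = n - d\<close>. Almost surely the points are in general position, and then a facet is the hull of
  \<open>d\<close> of the points whose affine hull has the other \<open>m\<close> points strictly on one side
  (\<open>num_faces_eq_card_facet_sets\<close>, \<open>facet_set_general_position\<close>). For a fixed
  \<open>d\<close>-subset let \<open>v\<close> be a unit normal of the hyperplane through its points and \<open>h\<close> the signed distance of
  this hyperplane from the origin. Given these points, the projections of the others on \<open>v\<close> are
  independent standard normal variables, so all of them lie on one side with probability
  \<open>\<Phi>(h)^m + \<Phi>(-h)^m\<close>, where \<open>\<Phi>\<close> is the standard normal distribution function.

  The distance \<open>h\<close> is normal with variance \<open>1/d\<close> (\<open>nn_integral_signed_distance\<close>): \<open>v\<close> depends
  only on the differences of the \<open>d\<close> points, \<open>h\<close> is the projection on \<open>v\<close> of their mean, and the mean,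
  whose coordinates are normal with variance \<open>1/d\<close>, is independent of the differences. Hence
  (\<open>expected_num_facets\<close>) the expected number of facets is \<open>2 (n choose d) E \<Phi>(N/\<surd>d)^m\<close> with \<open>N\<close>
  standard normal.

  The asymptotics come from an inequality valid for all \<open>x\<close>: with \<open>b = \<surd>(2/\<pi>)\<close>,
  \<open>exp (b x - x\<^sup>2/2) \<le> 2 \<Phi>(x) \<le> exp (b x)\<close> (\<open>normal_cdf_lower\<close>, \<open>normal_cdf_upper\<close>). Raised to the
  power \<open>m\<close>, both bounds have explicit Gaussian integrals, and
  \<open>ln E (2 \<Phi>(N/\<surd>d))^m\<close> lies between \<open>m\<^sup>2/(\<pi> d) - m^3/(\<pi> d\<^sup>2) - m/(2d)\<close> and \<open>m\<^sup>2/(\<pi> d)\<close>. The theorem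
  follows with \<open>C = 1/\<pi>\<close>, since \<open>m/d\<close> tends to \<open>0\<close>.
\<close>

section \<open>Orthogonal projection in coordinate space\<close>

abbreviation coord :: "(nat \<Rightarrow>\<^sub>0 real) \<Rightarrow> nat \<Rightarrow> real" where
  "coord \<equiv> Poly_Mapping.lookup"

abbreviation unit_vec :: "nat \<Rightarrow> (nat \<Rightarrow>\<^sub>0 real)" where
  "unit_vec k \<equiv> Poly_Mapping.single k 1"

lemma coord_scaleR: "coord (r *\<^sub>R x) k = r * coord x k"
proof -
  have "finite {i. r *\<^sub>R coord x i \<noteq> 0}"
    by (rule finite_subset[OF _ finite_keys[of x]]) (auto simp: in_keys_iff)
  then show ?thesis
    unfolding scaleR_poly_mapping_def by (subst Abs_poly_mapping_inverse) auto
qed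

lemma coord_sum: "coord (sum f A) k = (\<Sum>i\<in>A. coord (f i) k)"
  by (induction A rule: infinite_finite_induct) (auto simp: lookup_add)

definition coord_space :: "nat \<Rightarrow> (nat \<Rightarrow>\<^sub>0 real) set" where
  "coord_space d = {x. \<forall>k\<ge>d. coord x k = 0}"

definition ip :: "nat \<Rightarrow> (nat \<Rightarrow>\<^sub>0 real) \<Rightarrow> (nat \<Rightarrow>\<^sub>0 real) \<Rightarrow> real" where
  "ip d x y = (\<Sum>k<d. coord x k * coord y k)"

lemma ip_add_right: "ip d x (y + z) = ip d x y + ip d x z"
  and ip_diff_right: "ip d x (y - z) = ip d x y - ip d x z"
  and ip_scaleR_right: "ip d x (r *\<^sub>R y) = r * ip d x y"
  and ip_zero_right: "ip d x 0 = 0"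
  by (simp_all add: ip_def lookup_add lookup_minus coord_scaleR algebra_simps sum.distrib
      sum_subtractf sum_distrib_left)

lemma ip_commute: "ip d x y = ip d y x"
  by (simp add: ip_def mult.commute)

lemma ip_add_left: "ip d (y + z) x = ip d y x + ip d z x"
  and ip_diff_left: "ip d (y - z) x = ip d y x - ip d z x"
  and ip_scaleR_left: "ip d (r *\<^sub>R y) x = r * ip d y x"
  and ip_zero_left: "ip d 0 x = 0"
  by (simp_all add: ip_commute[of d _ x] ip_add_right ip_diff_right ip_scaleR_right ip_zero_right)

lemma ip_sum_right: "ip d x (sum f A) = (\<Sum>i\<in>A. ip d x (f i))"
  by (induction A rule: infinite_finite_induct) (auto simp: ip_add_right ip_zero_right)

lemmas ip_linear = ip_add_right ip_diff_right ip_scaleR_right ip_zero_right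
  ip_add_left ip_diff_left ip_scaleR_left ip_zero_left

lemma ip_self_nonneg: "0 \<le> ip d x x"
  by (auto simp: ip_def intro!: sum_nonneg)

lemma subspace_coord_space: "subspace (coord_space d)"
  by (auto simp: subspace_def coord_space_def lookup_add coord_scaleR)

lemma ip_self_eq_0_iff:
  assumes "x \<in> coord_space d"
  shows "ip d x x = 0 \<longleftrightarrow> x = 0"
proof
  assume "ip d x x = 0"
  then have "\<forall>k<d. coord x k = 0"
    unfolding ip_def by (subst (asm) sum_nonneg_eq_0_iff) auto
  then show "x = 0"
    using assms by (intro poly_mapping_eqI) (auto simp: coord_space_def not_less[symmetric])
qed (simp add: ip_zero_right)

lemma ip_orthogonal_span:
  assumes "x \<in> span S" "\<And>y. y \<in> S \<Longrightarrow> ip d v y = 0"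
  shows "ip d v x = 0"
  using assms(1)
proof (induction rule: span_induct_alt)
  case (step c x y)
  then show ?case using assms(2) by (simp add: ip_linear)
qed (simp add: ip_linear)

lemma unit_vec_in_coord_space: "k < d \<Longrightarrow> unit_vec k \<in> coord_space d"
  by (auto simp: coord_space_def lookup_single when_def)

lemma coord_space_expand:
  assumes "x \<in> coord_space d"
  shows "x = (\<Sum>k<d. coord x k *\<^sub>R unit_vec k)"
proof (rule poly_mapping_eqI)
  fix j
  have "coord (\<Sum>k<d. coord x k *\<^sub>R unit_vec k) j = (\<Sum>k<d. if k = j then coord x k else 0)"
    unfolding coord_sum coord_scaleR by (intro sum.cong) (auto simp: lookup_single when_def)
  also have "\<dots> = coord x j"
    using assms by (auto simp: coord_space_def)
  finally show "coord x j = coord (\<Sum>k<d. coord x k *\<^sub>R unit_vec k) j" ..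
qed

lemma coord_space_span: "coord_space d = span (unit_vec ` {..<d})"
proof
  show "coord_space d \<subseteq> span (unit_vec ` {..<d})"
  proof
    fix x assume x: "x \<in> coord_space d"
    have "(\<Sum>k<d. coord x k *\<^sub>R unit_vec k) \<in> span (unit_vec ` {..<d})"
      by (intro span_sum span_mul span_base) auto
    then show "x \<in> span (unit_vec ` {..<d})"
      using coord_space_expand[OF x] by simp
  qed
  show "span (unit_vec ` {..<d}) \<subseteq> coord_space d"
    by (rule span_minimal) (auto simp: unit_vec_in_coord_space subspace_coord_space)
qed

lemma independent_unit_vecs: "independent (unit_vec ` {..<d})"
proof (induction d)
  case (Suc d)
  have "unit_vec d \<notin> span (unit_vec ` {..<d})"
    by (simp add: coord_space_span[symmetric] coord_space_def) (use lookup_single_eq in force)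
  then show ?case
    by (simp add: lessThan_Suc independent_insertI Suc)
qed (simp add: independent_empty)

lemma card_unit_vecs: "card (unit_vec ` {..<d}) = d"
proof -
  have "inj_on (unit_vec :: nat \<Rightarrow> _) {..<d}"
    by (rule inj_onI) (metis lookup_single_eq lookup_single_not_eq zero_neq_one)
  then show ?thesis by (simp add: card_image)
qed

lemma independent_card_le_coord_space:
  assumes "independent S" "S \<subseteq> coord_space d"
  shows "finite S \<and> card S \<le> d"
  using independent_span_bound[of "unit_vec ` {..<d}" S] assms
  by (simp add: coord_space_span card_unit_vecs)

lemma spanning_card_ge_coord_space:
  assumes "finite S" "coord_space d \<subseteq> span S"
  shows "d \<le> card S"
proof -
  have "unit_vec ` {..<d} \<subseteq> span S"
    using assms(2) unit_vec_in_coord_space by blast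
  then show ?thesis
    using independent_span_bound[OF assms(1) independent_unit_vecs, of d] by (simp add: card_unit_vecs)
qed

text \<open>
  The projection onto the orthogonal complement of a list of vectors, by Gram-Schmidt. If \<open>D\<close> is
  already in the span of \<open>Ds\<close>, its own projection is zero; the quotient is then \<open>0 / 0 = 0\<close> and the step
  changes nothing. Without a case distinction, the coordinates of the result are evidently measurable
  functions of the coordinates of the arguments.
\<close>

primrec orth_proj :: "nat \<Rightarrow> (nat \<Rightarrow>\<^sub>0 real) list \<Rightarrow> (nat \<Rightarrow>\<^sub>0 real) \<Rightarrow> (nat \<Rightarrow>\<^sub>0 real)" where
  "orth_proj d [] x = x"
| "orth_proj d (D # Ds) x = orth_proj d Ds x -
     (ip d (orth_proj d Ds D) (orth_proj d Ds x) / ip d (orth_proj d Ds D) (orth_proj d Ds D)) *\<^sub>R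
     orth_proj d Ds D"

lemma orth_proj_in_coord_space:
  "set Ds \<subseteq> coord_space d \<Longrightarrow> x \<in> coord_space d \<Longrightarrow> orth_proj d Ds x \<in> coord_space d"
  by (induction Ds arbitrary: x)
    (auto intro!: subspace_diff[OF subspace_coord_space] subspace_scale[OF subspace_coord_space])

lemma diff_orth_proj_in_span: "x - orth_proj d Ds x \<in> span (set Ds)"
proof (induction Ds arbitrary: x)
  case (Cons D Ds)
  define P where "P = orth_proj d Ds"
  have IH: "y - P y \<in> span (insert D (set Ds))" for y
    using Cons[of y] span_mono[of "set Ds" "insert D (set Ds)"] by (auto simp: P_def)
  have "P D \<in> span (insert D (set Ds))"
    using span_diff[OF span_base[of D "insert D (set Ds)"] IH[of D]] by simp
  then have "(x - P x) + c *\<^sub>R P D \<in> span (insert D (set Ds))" for c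
    by (intro span_add IH span_mul)
  then show ?case
    by (simp add: P_def[symmetric] algebra_simps)
qed (simp add: span_zero)

text \<open>
  Write \<open>P\<close> for the projection along the tail. Since \<open>y - P y\<close> is in the span of the tail, to which \<open>P z\<close>
  is orthogonal, \<open>y\<close> and \<open>P y\<close> have the same inner product with \<open>P z\<close>. Removing the component along
  \<open>P E\<close> therefore makes a vector orthogonal to \<open>E\<close> itself.
\<close>

lemma orth_proj_orthogonal:
  assumes "set Ds \<subseteq> coord_space d" "D \<in> set Ds"
  shows "ip d D (orth_proj d Ds x) = 0"
  using assms
proof (induction Ds arbitrary: D x)
  case (Cons E Ds)
  define P where "P = orth_proj d Ds"
  have orth: "ip d y (P z) = ip d (P y) (P z)" for y z
  proof -
    have "ip d (P z) (y - P y) = 0"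
      using Cons.IH Cons.prems(1)
      by (intro ip_orthogonal_span[OF diff_orth_proj_in_span[of y d Ds, folded P_def]])
        (auto simp: P_def ip_commute)
    then show ?thesis by (simp add: ip_linear ip_commute)
  qed
  have mem: "P E \<in> coord_space d"
    using Cons.prems(1) by (auto simp: P_def intro!: orth_proj_in_coord_space)
  show ?case
  proof (cases "D \<in> set Ds")
    case True
    then have "ip d D (P y) = 0" for y
      using Cons.IH[of D y] Cons.prems(1) by (simp add: P_def)
    then show ?thesis by (simp add: P_def[symmetric] ip_linear)
  next
    case False
    then have "D = E" using Cons.prems by simp
    then show ?thesis
      using ip_self_eq_0_iff[OF mem] orth[of E E] orth[of E x]
      by (cases "P E = 0") (simp_all add: P_def[symmetric] ip_linear)
  qed
qed simp

lemma orth_proj_eq_0_iff: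
  assumes "set Ds \<subseteq> coord_space d" "x \<in> coord_space d"
  shows "orth_proj d Ds x = 0 \<longleftrightarrow> x \<in> span (set Ds)"
proof
  assume "orth_proj d Ds x = 0"
  then show "x \<in> span (set Ds)" using diff_orth_proj_in_span[of x d Ds] by simp
next
  let ?p = "orth_proj d Ds x"
  assume "x \<in> span (set Ds)"
  then have "?p \<in> span (set Ds)"
    using span_diff[OF _ diff_orth_proj_in_span[of x d Ds]] by fastforce
  then have "ip d ?p ?p = 0"
    by (rule ip_orthogonal_span) (use orth_proj_orthogonal[OF assms(1)] ip_commute in metis)
  then show "?p = 0"
    using ip_self_eq_0_iff orth_proj_in_coord_space assms by blast
qed

text \<open>
  Fewer than \<open>d\<close> vectors do not span the space, so the projection of some basis vector is nonzero.
  Taking the first such basis vector makes the choice of a normal measurable, also for linearly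
  dependent \<open>Ds\<close>. The inner product with itself, rather than the vector, is compared with zero because
  it is a real measurable function.
\<close>

definition normal_dir :: "nat \<Rightarrow> (nat \<Rightarrow>\<^sub>0 real) list \<Rightarrow> (nat \<Rightarrow>\<^sub>0 real)" where
  "normal_dir d Ds =
    orth_proj d Ds (unit_vec (LEAST k. ip d (orth_proj d Ds (unit_vec k)) (orth_proj d Ds (unit_vec k)) \<noteq> 0))"

definition unit_normal :: "nat \<Rightarrow> (nat \<Rightarrow>\<^sub>0 real) list \<Rightarrow> (nat \<Rightarrow>\<^sub>0 real)" where
  "unit_normal d Ds = (1 / sqrt (ip d (normal_dir d Ds) (normal_dir d Ds))) *\<^sub>R normal_dir d Ds"

lemma unit_normal:
  assumes Ds: "set Ds \<subseteq> coord_space d" and len: "length Ds < d"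
  shows unit_normal_in_coord_space: "unit_normal d Ds \<in> coord_space d"
    and unit_normal_norm: "ip d (unit_normal d Ds) (unit_normal d Ds) = 1"
    and unit_normal_orthogonal: "D \<in> set Ds \<Longrightarrow> ip d (unit_normal d Ds) D = 0"
proof -
  let ?Q = "\<lambda>k. ip d (orth_proj d Ds (unit_vec k)) (orth_proj d Ds (unit_vec k)) \<noteq> 0"
  have "\<exists>k<d. ?Q k"
  proof (rule ccontr)
    assume "\<not> (\<exists>k<d. ?Q k)"
    then have "unit_vec k \<in> span (set Ds)" if "k < d" for k
      using orth_proj_in_coord_space[OF Ds unit_vec_in_coord_space[OF that]]
        orth_proj_eq_0_iff[OF Ds unit_vec_in_coord_space[OF that]] ip_self_eq_0_iff that by blast
    then have "coord_space d \<subseteq> span (set Ds)"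
      unfolding coord_space_span by (intro span_minimal) auto
    from spanning_card_ge_coord_space[OF _ this] show False
      using card_length[of Ds] len by simp
  qed
  then obtain k where k: "k < d" "?Q k" by blast
  define l where "l = (LEAST k. ?Q k)"
  have l: "?Q l" "l < d"
    using LeastI[of ?Q k] Least_le[of ?Q k] k by (auto simp: l_def)
  define w where "w = normal_dir d Ds"
  have w_eq: "w = orth_proj d Ds (unit_vec l)"
    by (simp add: w_def normal_dir_def l_def)
  have w: "w \<in> coord_space d"
    unfolding w_eq by (intro orth_proj_in_coord_space Ds unit_vec_in_coord_space l)
  have pos: "ip d w w > 0"
    using l(1) ip_self_nonneg[of d w] by (simp add: w_eq)
  have u: "unit_normal d Ds = (1 / sqrt (ip d w w)) *\<^sub>R w"
    by (simp add: unit_normal_def w_def)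
  show "unit_normal d Ds \<in> coord_space d"
    unfolding u by (intro subspace_scale[OF subspace_coord_space] w)
  show "ip d (unit_normal d Ds) (unit_normal d Ds) = 1"
    unfolding u using pos by (simp add: ip_linear)
  show "ip d (unit_normal d Ds) D = 0" if "D \<in> set Ds"
    unfolding u using orth_proj_orthogonal[OF Ds that] by (simp add: ip_linear w_eq ip_commute)
qed

primrec indep_list :: "nat \<Rightarrow> (nat \<Rightarrow>\<^sub>0 real) list \<Rightarrow> bool" where
  "indep_list d [] \<longleftrightarrow> True"
| "indep_list d (D # Ds) \<longleftrightarrow> indep_list d Ds \<and> orth_proj d Ds D \<noteq> 0"

lemma indep_list_iff:
  assumes "set Ds \<subseteq> coord_space d"
  shows "indep_list d Ds \<longleftrightarrow> distinct Ds \<and> independent (set Ds)"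
  using assms
proof (induction Ds)
  case (Cons D Ds)
  have "independent (insert D (set Ds)) \<Longrightarrow> D \<notin> set Ds \<Longrightarrow> D \<notin> span (set Ds)"
    unfolding dependent_def by auto
  moreover have "independent (insert D (set Ds)) \<Longrightarrow> independent (set Ds)"
    by (meson independent_mono subset_insertI)
  ultimately show ?case
    using Cons orth_proj_eq_0_iff[of Ds d D] by (auto simp: independent_insert intro: span_base)
qed (simp add: independent_empty)

text \<open>
  The \<open>d - 1\<close> independent vectors and their normal form a basis, and a vector orthogonal to the normal
  has no component along it.
\<close>

lemma orthogonal_unit_normal_in_span:
  assumes Ds: "set Ds \<subseteq> coord_space d" and len: "Suc (length Ds) = d"
    and ind: "distinct Ds" "independent (set Ds)"
    and x: "x \<in> coord_space d" and orth: "ip d (unit_normal d Ds) x = 0"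
  shows "x \<in> span (set Ds)"
proof -
  let ?u = "unit_normal d Ds"
  have len': "length Ds < d" using len by simp
  note u = unit_normal[OF Ds len']
  have "?u \<notin> span (set Ds)"
    using ip_orthogonal_span[of ?u "set Ds" d ?u] u by auto
  then have indep: "independent (insert ?u (set Ds))" and "?u \<notin> set Ds"
    using ind by (auto simp: independent_insert intro: span_base)
  then have card: "card (insert ?u (set Ds)) = d"
    using len distinct_card[OF ind(1)] by simp
  have "x \<in> span (insert ?u (set Ds))"
  proof (rule ccontr)
    assume x': "x \<notin> span (insert ?u (set Ds))"
    then have ind': "independent (insert x (insert ?u (set Ds)))"
      using indep by (rule independent_insertI)
    have sub: "insert x (insert ?u (set Ds)) \<subseteq> coord_space d"
      using x u Ds by auto
    have "x \<notin> insert ?u (set Ds)"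
      using x' span_base[of x "insert ?u (set Ds)"] by fast
    then have "card (insert x (insert ?u (set Ds))) = Suc d"
      using card card_insert_disjoint[of "insert ?u (set Ds)" x] by simp
    then show False
      using independent_card_le_coord_space[OF ind' sub] by linarith
  qed
  then obtain a where a: "x - a *\<^sub>R ?u \<in> span (set Ds)"
    by (auto simp: span_insert)
  have "ip d ?u (x - a *\<^sub>R ?u) = 0"
    by (rule ip_orthogonal_span[OF a]) (use u in auto)
  then have "a = 0" using orth u by (simp add: ip_linear)
  then show ?thesis using a by simp
qed

section \<open>Affine dimension and faces of convex hulls\<close>

lemma differences_of_translated_subspace:
  assumes "subspace S"
  shows "{x - y |x y. x \<in> (+) a ` S \<and> y \<in> (+) a ` S} = S"
proof
  show "{x - y |x y. x \<in> (+) a ` S \<and> y \<in> (+) a ` S} \<subseteq> S"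
    using subspace_diff[OF assms] by auto
  show "S \<subseteq> {x - y |x y. x \<in> (+) a ` S \<and> y \<in> (+) a ` S}"
  proof
    fix s assume "s \<in> S"
    moreover have "s = (a + s) - (a + 0)" by simp
    ultimately show "s \<in> {x - y |x y. x \<in> (+) a ` S \<and> y \<in> (+) a ` S}"
      using subspace_0[OF assms] by blast
  qed
qed

text \<open>
  The affine dimension is defined by choosing some affinely independent set with the right hull; its
  value is known once all such sets are seen to have the same cardinality. Subtracting a point turns
  both sets into bases of the same linear space.
\<close>

lemma affine_independent_same_hull_card:
  fixes B B' :: "'a::real_vector set"
  assumes "finite B" "B \<noteq> {}" "\<not> affine_dependent B" "\<not> affine_dependent B'"
    and eq: "affine hull B = affine hull B'"
  shows "finite B' \<and> card B' = card B"
proof -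
  obtain a where a: "a \<in> B" using assms by blast
  have "B' \<noteq> {}" using eq \<open>B \<noteq> {}\<close> by force
  then obtain a' where a': "a' \<in> B'" by blast
  define D where "D = (\<lambda>x. - a + x) ` (B - {a})"
  define D' where "D' = (\<lambda>x. - a' + x) ` (B' - {a'})"
  have hull: "affine hull B = (+) a ` span D" "affine hull B' = (+) a' ` span D'"
    using affine_hull_span2[OF a] affine_hull_span2[OF a'] by (simp_all add: D_def D'_def)
  have "span D = {x - y |x y. x \<in> affine hull B \<and> y \<in> affine hull B}"
    unfolding hull(1) by (rule differences_of_translated_subspace[symmetric]) (rule subspace_span)
  also have "\<dots> = span D'"
    unfolding eq hull(2) by (rule differences_of_translated_subspace) (rule subspace_span)
  finally have span: "span D = span D'" .
  have ind: "independent D" "independent D'"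
    using affine_dependent_iff_dependent2[OF a] affine_dependent_iff_dependent2[OF a'] assms
    by (simp_all add: D_def D'_def)
  have finD: "finite D" using assms by (simp add: D_def)
  have finD': "finite D'"
    using independent_span_bound[OF finD ind(2)] span span_superset[of D'] by auto
  have "card D = card D'"
    using dim_eq_card[OF refl ind(1)] dim_eq_card[OF span[symmetric] ind(2)] by simp
  moreover have "card D = card (B - {a})"
    unfolding D_def by (rule card_image) (auto simp: inj_on_def)
  moreover have inj: "inj_on (\<lambda>x. - a' + x) (B' - {a'})" by (auto simp: inj_on_def)
  moreover have "card D' = card (B' - {a'})"
    unfolding D'_def by (rule card_image[OF inj])
  moreover have fin: "finite B'"
    using finD' finite_image_iff[OF inj] by (simp add: D'_def)
  ultimately show ?thesis
    using a a' assms(1) by (metis card_Suc_Diff1)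
qed

lemma affine_dim_eqI:
  assumes "finite B" "B \<noteq> {}" "\<not> affine_dependent B" "affine hull B = affine hull V"
  shows "affine_dim V = int (card B) - 1"
  unfolding affine_dim_def
proof (rule some_equality)
  show "\<exists>B'. affine hull B' = affine hull V \<and> \<not> affine_dependent B' \<and> of_nat (card B') = int (card B) - 1 + 1"
    using assms by auto
next
  fix e :: int assume "\<exists>B'. affine hull B' = affine hull V \<and> \<not> affine_dependent B' \<and> of_nat (card B') = e + 1"
  then show "e = int (card B) - 1"
    using affine_independent_same_hull_card[OF assms(1-3)] assms(4) by auto
qed

lemma affine_dim_empty: "affine_dim ({} :: 'a::real_vector set) = -1"
  unfolding affine_dim_def
proof (rule some_equality)
  show "\<exists>B. affine hull B = affine hull {} \<and> \<not> affine_dependent B \<and> of_nat (card B) = - 1 + (1 :: int)"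
    by (rule exI[of _ "{}"]) (simp add: affine_dependent_def)
qed auto

lemma affine_basis_of_finite:
  fixes S :: "'a::real_vector set"
  assumes "finite S" "affine_dim (convex hull S) = int k"
  obtains B where "B \<subseteq> S" "\<not> affine_dependent B" "affine hull B = affine hull S" "card B = Suc k"
proof -
  obtain B where B: "B \<subseteq> S" "\<not> affine_dependent B" "affine hull S = affine hull B"
    using affine_basis_exists by blast
  have "S \<noteq> {}" using assms(2) affine_dim_empty[where 'a = 'a] by auto
  then have "B \<noteq> {}" using B by auto
  have "affine_dim (convex hull S) = int (card B) - 1"
    by (rule affine_dim_eqI) (use B assms \<open>B \<noteq> {}\<close> finite_subset in \<open>auto simp: affine_hull_convex_hull\<close>)
  then show ?thesis using that B assms by auto
qed

text \<open>
  In a convex combination that lies in a face, every point with positive weight lies in the face: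
  the combination is inside the segment from that point to the normalised combination of the others.
\<close>

lemma face_of_convex_hull_finite_eq:
  fixes S :: "'a::real_vector set"
  assumes "finite S" and F: "F face_of convex hull S"
  shows "F = convex hull (S \<inter> F)"
proof
  have cF: "convex F" and FS: "F \<subseteq> convex hull S"
    using F by (auto simp: face_of_def)
  show "convex hull (S \<inter> F) \<subseteq> F"
    by (rule hull_minimal) (use cF in auto)
  show "F \<subseteq> convex hull (S \<inter> F)"
  proof
    fix y assume y: "y \<in> F"
    then have "y \<in> convex hull S" using FS by auto
    then obtain u where u: "\<forall>x\<in>S. 0 \<le> u x" "sum u S = 1" "(\<Sum>x\<in>S. u x *\<^sub>R x) = y"
      unfolding convex_hull_finite[OF \<open>finite S\<close>] by auto
    have pos: "x \<in> F" if x: "x \<in> S" "u x > 0" for x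
    proof (cases "u x = 1")
      case True
      have "sum u (S - {x}) = 0" using u(2) True x \<open>finite S\<close> by (simp add: sum.remove)
      then have "\<forall>z\<in>S - {x}. u z = 0"
        using u(1) \<open>finite S\<close> by (subst (asm) sum_nonneg_eq_0_iff) auto
      then have "y = x"
        using u(3) True x \<open>finite S\<close> by (simp add: sum.remove[of S x])
      then show ?thesis using y by simp
    next
      case False
      have rest: "sum u (S - {x}) = 1 - u x"
        using u(2) x \<open>finite S\<close> by (simp add: sum.remove)
      then have lt: "u x < 1"
        using sum_nonneg[of "S - {x}" u] u(1) False by (auto simp: less_le)
      define z where "z = (\<Sum>v\<in>S - {x}. (u v / (1 - u x)) *\<^sub>R v)"
      have z: "z \<in> convex hull S"
        unfolding z_def
      proof (rule convex_sum)
        show "(\<Sum>v\<in>S - {x}. u v / (1 - u x)) = 1"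
          using rest lt by (simp add: sum_divide_distrib[symmetric])
      qed (use \<open>finite S\<close> u(1) lt in \<open>auto intro: hull_inc\<close>)
      have "(1 - u x) *\<^sub>R z = (\<Sum>v\<in>S - {x}. u v *\<^sub>R v)"
        using lt by (simp add: z_def scaleR_sum_right)
      then have yeq: "y = (1 - u x) *\<^sub>R z + u x *\<^sub>R x"
        using u(3) x \<open>finite S\<close> by (simp add: sum.remove[of S x] add.commute)
      show ?thesis
      proof (cases "z = x")
        case True
        then have "y = x" using yeq by (simp add: algebra_simps)
        then show ?thesis using y by simp
      next
        case False
        then have "y \<in> open_segment z x"
          using yeq x lt by (auto simp: in_segment)
        then show ?thesis
          using face_ofD[OF F _ z hull_inc[OF x(1)] y] by blast
      qed
    qed
    have zero: "u x = 0" if "x \<in> S - S \<inter> F" for x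
      using pos[of x] that u(1) by (auto simp: less_le)
    have "sum u (S \<inter> F) = 1"
      using u(2) sum.mono_neutral_right[of S "S \<inter> F" u] zero \<open>finite S\<close> by auto
    moreover have "(\<Sum>x\<in>S \<inter> F. u x *\<^sub>R x) = y"
      using u(3) sum.mono_neutral_right[of S "S \<inter> F" "\<lambda>x. u x *\<^sub>R x"] zero \<open>finite S\<close> by auto
    ultimately show "y \<in> convex hull (S \<inter> F)"
      using u(1) \<open>finite S\<close> by (subst convex_hull_finite) auto
  qed
qed

text \<open>
  The barycentre \<open>c\<close> of \<open>B\<close> has positive weights, so moving from \<open>c\<close> a little in the direction away
  from \<open>p\<close> leads to a point \<open>q\<close> that is still in the hull of \<open>B\<close>, hence in the face. As \<open>c\<close> lies between
  \<open>p\<close> and \<open>q\<close>, the face also contains \<open>p\<close>.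
\<close>

lemma face_of_contains_affine_hull_points:
  fixes B :: "'a::real_vector set"
  assumes F: "F face_of P" and B: "finite B" "B \<subseteq> F" and p: "p \<in> P" "p \<in> affine hull B"
  shows "p \<in> F"
proof -
  have cF: "convex F" and FP: "F \<subseteq> P" using F by (auto simp: face_of_def)
  obtain w where w: "sum w B = 1" "(\<Sum>b\<in>B. w b *\<^sub>R b) = p"
    using p(2) unfolding affine_hull_finite[OF B(1)] by auto
  have ne: "B \<noteq> {}" using w by auto
  define r where "r = 1 / real (card B)"
  have r: "r > 0" and rs: "(\<Sum>b\<in>B. r) = 1" using ne B by (auto simp: r_def)
  \<comment> \<open>small enough that \<open>r + t * (r - w b)\<close> stays nonnegative for every weight \<open>w b\<close>\<close>
  define t where "t = r / (1 + (\<Sum>b\<in>B. \<bar>w b\<bar>))"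
  have s0: "0 \<le> (\<Sum>b\<in>B. \<bar>w b\<bar>)" by (intro sum_nonneg) auto
  have t: "t > 0" unfolding t_def using r s0 by (intro divide_pos_pos) linarith+
  define c where "c = (\<Sum>b\<in>B. r *\<^sub>R b)"
  define q where "q = (\<Sum>b\<in>B. (r + t * (r - w b)) *\<^sub>R b)"
  have "c \<in> F" unfolding c_def
    by (rule convex_sum[OF B(1) cF rs]) (use r B in auto)
  have "q \<in> F" unfolding q_def
  proof (rule convex_sum[OF B(1) cF])
    show "(\<Sum>b\<in>B. r + t * (r - w b)) = 1"
      using rs w by (simp add: sum.distrib sum_distrib_left[symmetric] sum_subtractf)
    fix b assume b: "b \<in> B"
    have "\<bar>w b\<bar> \<le> (\<Sum>b\<in>B. \<bar>w b\<bar>)"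
      by (rule member_le_sum) (use b B in auto)
    then have "t * w b \<le> t * (1 + (\<Sum>b\<in>B. \<bar>w b\<bar>))"
      using t by (intro mult_left_mono) auto
    also have "\<dots> = r"
    proof -
      have "1 + (\<Sum>b\<in>B. \<bar>w b\<bar>) \<noteq> 0" using s0 by linarith
      then show ?thesis by (simp add: t_def)
    qed
    finally have "t * w b \<le> r" .
    moreover have "0 \<le> t * r" using t r by simp
    ultimately show "0 \<le> r + t * (r - w b)" by (simp add: right_diff_distrib)
    show "b \<in> F" using b B by auto
  qed
  have "q = c + t *\<^sub>R (c - p)"
    by (simp add: q_def c_def w(2)[symmetric] algebra_simps sum.distrib sum_subtractf scaleR_sum_right)
  then have "(1 + t) *\<^sub>R c = q + t *\<^sub>R p" by (simp add: algebra_simps)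
  then have "(1 / (1 + t)) *\<^sub>R ((1 + t) *\<^sub>R c) = (1 / (1 + t)) *\<^sub>R (q + t *\<^sub>R p)" by simp
  moreover have "(1 / (1 + t)) *\<^sub>R ((1 + t) *\<^sub>R c) = c" using t by simp
  moreover have "1 - t / (1 + t) = 1 / (1 + t)" using t by (simp add: field_simps)
  ultimately have c: "c = (1 - t / (1 + t)) *\<^sub>R q + (t / (1 + t)) *\<^sub>R p"
    by (simp add: scaleR_add_right)
  show ?thesis
  proof (cases "q = p")
    case False
    have "c \<in> open_segment q p"
      unfolding in_segment using c t False by (intro conjI exI[of _ "t / (1 + t)"]) auto
    then show ?thesis
      using face_ofD[OF F _ _ p(1) \<open>c \<in> F\<close>, of q] FP \<open>q \<in> F\<close> by blast
  qed (use \<open>q \<in> F\<close> in simp)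
qed

text \<open>
  The next two lemmas describe the face cut out by a supporting hyperplane. The hyperplane is the zero
  set of an affine function \<open>f\<close>; affinity is assumed in just the form each proof uses.
\<close>

lemma convex_hull_zero_set_eq:
  fixes S :: "'a::real_vector set" and f :: "'a \<Rightarrow> real"
  assumes "finite S" and lin: "\<And>u. sum u S = 1 \<Longrightarrow> f (\<Sum>x\<in>S. u x *\<^sub>R x) = (\<Sum>x\<in>S. u x * f x)"
    and nonneg: "\<And>x. x \<in> S \<Longrightarrow> 0 \<le> f x"
  shows "{y \<in> convex hull S. f y = 0} = convex hull {x \<in> S. f x = 0}" (is "?L = convex hull ?T")
proof
  show "?L \<subseteq> convex hull ?T"
  proof
    fix y assume y: "y \<in> ?L"
    then obtain u where u: "\<forall>x\<in>S. 0 \<le> u x" "sum u S = 1" "(\<Sum>x\<in>S. u x *\<^sub>R x) = y"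
      unfolding convex_hull_finite[OF \<open>finite S\<close>] by auto
    have "(\<Sum>x\<in>S. u x * f x) = 0" using lin[OF u(2)] u(3) y by simp
    then have z: "\<forall>x\<in>S. u x * f x = 0"
      using u(1) nonneg \<open>finite S\<close> by (subst (asm) sum_nonneg_eq_0_iff) auto
    then have zero: "u x = 0" if "x \<in> S - ?T" for x using that by auto
    have "sum u ?T = 1"
      using u(2) sum.mono_neutral_right[of S ?T u] zero \<open>finite S\<close> by auto
    moreover have "(\<Sum>x\<in>?T. u x *\<^sub>R x) = y"
      using u(3) sum.mono_neutral_right[of S ?T "\<lambda>x. u x *\<^sub>R x"] zero \<open>finite S\<close> by auto
    ultimately show "y \<in> convex hull ?T"
      using u(1) \<open>finite S\<close> by (subst convex_hull_finite) auto
  qed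
  show "convex hull ?T \<subseteq> ?L"
  proof
    fix y assume y: "y \<in> convex hull ?T"
    then obtain u where u: "\<forall>x\<in>?T. 0 \<le> u x" "sum u ?T = 1" "(\<Sum>x\<in>?T. u x *\<^sub>R x) = y"
      using \<open>finite S\<close> by (subst (asm) convex_hull_finite) auto
    define v where "v x = (if f x = 0 then u x else 0)" for x
    have "sum v S = 1"
      using u(2) \<open>finite S\<close> by (simp add: v_def sum.If_cases Int_def)
    moreover have "(\<Sum>x\<in>S. v x *\<^sub>R x) = y"
      using u(3) \<open>finite S\<close> by (simp add: v_def if_distrib[of "\<lambda>r. r *\<^sub>R _"] sum.If_cases Int_def cong: if_cong)
    ultimately have "f y = (\<Sum>x\<in>S. v x * f x)" using lin by blast
    also have "\<dots> = 0" by (intro sum.neutral) (simp add: v_def)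
    finally show "y \<in> ?L" using y hull_mono[of ?T S convex] by auto
  qed
qed

lemma zero_set_face_of:
  fixes P :: "'a::real_vector set" and f :: "'a \<Rightarrow> real"
  assumes "convex P" and lin: "\<And>x y u. f ((1 - u) *\<^sub>R x + u *\<^sub>R y) = (1 - u) * f x + u * f y"
    and nonneg: "\<And>x. x \<in> P \<Longrightarrow> 0 \<le> f x"
  shows "{y \<in> P. f y = 0} face_of P"
  unfolding face_of_def
proof (intro conjI ballI impI)
  show "convex {y \<in> P. f y = 0}"
    unfolding convex_alt using \<open>convex P\<close> by (auto simp: lin convex_alt)
  fix a b x assume ab: "a \<in> P" "b \<in> P" and x: "x \<in> {y \<in> P. f y = 0}" "x \<in> open_segment a b"
  then obtain u where u: "0 < u" "u < 1" "x = (1 - u) *\<^sub>R a + u *\<^sub>R b" by (auto simp: in_segment)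
  have "(1 - u) * f a + u * f b = 0" using x u lin by auto
  moreover have "0 \<le> (1 - u) * f a" "0 \<le> u * f b" using u ab nonneg by auto
  ultimately have "(1 - u) * f a = 0" "u * f b = 0" by linarith+
  then show "a \<in> {y \<in> P. f y = 0}" "b \<in> {y \<in> P. f y = 0}" using u ab by auto
qed auto

section \<open>Facets as sets of indices\<close>

text \<open>
  The hyperplane through the points indexed by \<open>B\<close> is given by a base point and the differences to it.
  A normal computed from the differences alone does not change when all points are translated, which
  is what the distribution of the distance from the origin rests on.
\<close>

definition edge_list :: "(nat \<Rightarrow> (nat \<Rightarrow>\<^sub>0 real)) \<Rightarrow> nat set \<Rightarrow> (nat \<Rightarrow>\<^sub>0 real) list" where
  "edge_list x B = map (\<lambda>i. x i - x (Min B)) (sorted_list_of_set (B - {Min B}))"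

definition side :: "nat \<Rightarrow> (nat \<Rightarrow> (nat \<Rightarrow>\<^sub>0 real)) \<Rightarrow> nat set \<Rightarrow> (nat \<Rightarrow>\<^sub>0 real) \<Rightarrow> real" where
  "side d x B p = ip d (unit_normal d (edge_list x B)) (p - x (Min B))"

text \<open>
  For \<open>I \<subseteq> {..<n}\<close> this says that \<open>I\<close> is the set of all indices of points on some facet: \<open>d\<close> affinely
  independent ones among them, indexed by \<open>B\<close>, span a hyperplane which contains the points of \<open>I\<close>
  and has all the others strictly on one side. The expectation is the integral of the number of faces
  itself, so that number must be a measurable function on all outcomes; hence the description covers
  degenerate configurations, where a facet can contain more than \<open>d\<close> of the points, or the polytope
  can be its own only facet.
\<close>

definition facet_set :: "nat \<Rightarrow> nat \<Rightarrow> (nat \<Rightarrow> (nat \<Rightarrow>\<^sub>0 real)) \<Rightarrow> nat set \<Rightarrow> bool" where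
  "facet_set d n x I \<longleftrightarrow> (\<exists>B\<in>Pow I. card B = d \<and> indep_list d (edge_list x B) \<and>
     (\<forall>i\<in>I. side d x B (x i) = 0) \<and>
     ((\<forall>j\<in>{..<n} - I. 0 < side d x B (x j)) \<or> (\<forall>j\<in>{..<n} - I. side d x B (x j) < 0)))"

lemma set_edge_list: "finite B \<Longrightarrow> set (edge_list x B) = (\<lambda>y. - x (Min B) + y) ` (x ` (B - {Min B}))"
  by (simp add: edge_list_def image_image)

lemma length_edge_list: "finite B \<Longrightarrow> B \<noteq> {} \<Longrightarrow> length (edge_list x B) = card B - 1"
  by (simp add: edge_list_def Min_in)

context
  fixes d :: nat and x :: "nat \<Rightarrow> (nat \<Rightarrow>\<^sub>0 real)" and B :: "nat set"
  assumes d: "1 \<le> d" and card_B: "card B = d" and x: "\<And>i. i \<in> B \<Longrightarrow> x i \<in> coord_space d"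
begin

private lemma fin: "finite B" and ne: "B \<noteq> {}" and Min_B: "Min B \<in> B"
  using d card_B card_gt_0_iff[of B] Min_in[of B] by auto

private lemma edges_in: "set (edge_list x B) \<subseteq> coord_space d"
  using x Min_B by (auto simp: set_edge_list[OF fin] intro!: subspace_diff[OF subspace_coord_space])

private lemma len: "Suc (length (edge_list x B)) = d" "length (edge_list x B) < d"
  using length_edge_list[OF fin ne] d card_B by simp_all

lemma indep_edge_list_iff:
  "indep_list d (edge_list x B) \<longleftrightarrow> inj_on x B \<and> \<not> affine_dependent (x ` B)"
proof -
  let ?b = "Min B"
  have dist: "distinct (edge_list x B) \<longleftrightarrow> inj_on x (B - {?b})"
    using fin by (simp add: edge_list_def distinct_map inj_on_def)
  have ind: "\<not> affine_dependent (x ` B) \<longleftrightarrow> independent (set (edge_list x B))" if "inj_on x B"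
  proof -
    have "x ` B - {x ?b} = x ` (B - {?b})"
      using inj_on_image_set_diff[OF that, of B "{?b}"] Min_B by auto
    then show ?thesis
      using affine_dependent_iff_dependent2[of "x ?b" "x ` B"] Min_B by (simp add: set_edge_list[OF fin])
  qed
  have "inj_on x B" if "indep_list d (edge_list x B)"
  proof -
    have "0 \<notin> set (edge_list x B)" and inj: "inj_on x (B - {?b})"
      using that dependent_zero by (auto simp: indep_list_iff[OF edges_in] dist)
    then have "x i \<noteq> x ?b" if i: "i \<in> B - {?b}" for i
    proof -
      have "- x ?b + x i \<in> set (edge_list x B)"
        using i by (auto simp: set_edge_list[OF fin])
      with \<open>0 \<notin> set (edge_list x B)\<close> show ?thesis by auto
    qed
    then have "x ?b \<notin> x ` (B - {?b})" by fastforce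
    then have "inj_on x (insert ?b (B - {?b}))" unfolding inj_on_insert using inj by simp
    then show ?thesis by (simp only: insert_Diff[OF Min_B])
  qed
  then show ?thesis
    using ind dist by (auto simp: indep_list_iff[OF edges_in] inj_on_diff)
qed

lemma unit_normal_edge_list:
  "ip d (unit_normal d (edge_list x B)) (unit_normal d (edge_list x B)) = 1"
  by (rule unit_normal_norm[OF edges_in len(2)])

lemma side_eq_0_of_affine_hull:
  assumes "p \<in> affine hull (x ` B)"
  shows "side d x B p = 0"
proof -
  have "x ` B = insert (x (Min B)) (x ` (B - {Min B}))" using Min_B by auto
  then have "p \<in> (+) (x (Min B)) ` span (set (edge_list x B))"
    using assms affine_hull_insert_span_gen[of "x (Min B)" "x ` (B - {Min B})"]
    by (simp add: set_edge_list[OF fin])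
  then have "p - x (Min B) \<in> span (set (edge_list x B))" by auto
  then show ?thesis
    unfolding side_def using unit_normal_orthogonal[OF edges_in len(2)]
    by (rule ip_orthogonal_span)
qed

lemma affine_hull_of_side_eq_0:
  assumes "indep_list d (edge_list x B)" "p \<in> coord_space d" "side d x B p = 0"
  shows "p \<in> affine hull (x ` B)"
proof -
  have "p - x (Min B) \<in> coord_space d"
    using assms x Min_B by (auto intro!: subspace_diff[OF subspace_coord_space])
  then have "p - x (Min B) \<in> span (set (edge_list x B))"
    using orthogonal_unit_normal_in_span[OF edges_in len(1)] assms
    by (auto simp: indep_list_iff[OF edges_in] side_def)
  then have "p \<in> (+) (x (Min B)) ` span (set (edge_list x B))"
    by (auto intro!: image_eqI[of _ _ "p - x (Min B)"])
  moreover have "x ` B = insert (x (Min B)) (x ` (B - {Min B}))" using Min_B by auto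
  ultimately show ?thesis
    using affine_hull_insert_span_gen[of "x (Min B)" "x ` (B - {Min B})"]
    by (simp add: set_edge_list[OF fin])
qed

end

lemma side_sum:
  assumes "sum u S = 1"
  shows "side d x B (\<Sum>y\<in>S. u y *\<^sub>R y) = (\<Sum>y\<in>S. u y * side d x B y)"
proof -
  have "(\<Sum>y\<in>S. u y *\<^sub>R y) - x (Min B) = (\<Sum>y\<in>S. u y *\<^sub>R (y - x (Min B)))"
    using assms by (simp add: scaleR_diff_right sum_subtractf scaleR_sum_left[symmetric])
  then show ?thesis by (simp add: side_def ip_sum_right ip_scaleR_right)
qed

lemma side_segment: "side d x B ((1 - u) *\<^sub>R p + u *\<^sub>R q) = (1 - u) * side d x B p + u * side d x B q"
  by (simp add: side_def ip_linear algebra_simps)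

text \<open>
  Up to its sign \<open>s\<close>, \<open>side\<close> is a supporting affine function whose zeros among the points are those of
  \<open>I\<close>. The third claim recovers \<open>I\<close> from the face, so that different index sets give different facets.
\<close>

lemma convex_hull_facet_set:
  fixes x :: "nat \<Rightarrow> (nat \<Rightarrow>\<^sub>0 real)"
  assumes d: "1 \<le> d" and x: "\<And>i. i < n \<Longrightarrow> x i \<in> coord_space d"
    and I: "I \<subseteq> {..<n}" "facet_set d n x I"
  shows "convex hull (x ` I) face_of convex hull (x ` {..<n})"
    and "affine_dim (convex hull (x ` I)) = int (d - 1)"
    and "{i\<in>{..<n}. x i \<in> convex hull (x ` I)} = I"
proof -
  obtain B where B: "B \<subseteq> I" "card B = d" "indep_list d (edge_list x B)"
    and zero: "\<And>i. i \<in> I \<Longrightarrow> side d x B (x i) = 0"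
    and sgn: "(\<forall>j\<in>{..<n} - I. 0 < side d x B (x j)) \<or> (\<forall>j\<in>{..<n} - I. side d x B (x j) < 0)"
    using I(2) unfolding facet_set_def by auto
  have xB: "x i \<in> coord_space d" if "i \<in> B" for i using that B I x by auto
  obtain s :: real where s: "s \<noteq> 0" "\<And>j. j \<in> {..<n} - I \<Longrightarrow> 0 < s * side d x B (x j)"
  proof (cases "\<forall>j\<in>{..<n} - I. 0 < side d x B (x j)")
    case True then show ?thesis using that[of 1] by auto
  next
    case False then show ?thesis using that[of "-1"] sgn by auto
  qed
  let ?f = "\<lambda>p. s * side d x B p"
  let ?P = "convex hull (x ` {..<n})"
  have nonneg: "0 \<le> ?f p" if "p \<in> x ` {..<n}" for p
    using that zero s(2) by (smt (verit) DiffI imageE mult_not_zero)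
  have sum: "?f (\<Sum>y\<in>x ` {..<n}. u y *\<^sub>R y) = (\<Sum>y\<in>x ` {..<n}. u y * ?f y)" if "sum u (x ` {..<n}) = 1" for u
    by (simp add: side_sum[OF that] sum_distrib_left algebra_simps)
  have "{p \<in> x ` {..<n}. ?f p = 0} = x ` I"
  proof
    show "{p \<in> x ` {..<n}. ?f p = 0} \<subseteq> x ` I" using s by force
    show "x ` I \<subseteq> {p \<in> x ` {..<n}. ?f p = 0}" using zero I by auto
  qed
  then have eq: "{p \<in> ?P. ?f p = 0} = convex hull (x ` I)"
    using convex_hull_zero_set_eq[of "x ` {..<n}" ?f, OF _ sum nonneg] by simp
  have nonneg': "0 \<le> ?f p" if p: "p \<in> ?P" for p
  proof -
    obtain u where u: "\<forall>y\<in>x ` {..<n}. 0 \<le> u y" "sum u (x ` {..<n}) = 1"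
      "(\<Sum>y\<in>x ` {..<n}. u y *\<^sub>R y) = p"
      using p unfolding convex_hull_finite[OF finite_imageI[OF finite_lessThan]] by auto
    show ?thesis
      unfolding u(3)[symmetric] sum[OF u(2)]
      by (intro sum_nonneg mult_nonneg_nonneg nonneg) (use u(1) in auto)
  qed
  show "convex hull (x ` I) face_of ?P"
    unfolding eq[symmetric]
    by (rule zero_set_face_of[OF _ _ nonneg']) (simp_all only: side_segment distrib_left mult.left_commute convex_convex_hull)
  show "{i\<in>{..<n}. x i \<in> convex hull (x ` I)} = I"
  proof (intro equalityI subsetI)
    fix i assume "i \<in> I"
    then show "i \<in> {i\<in>{..<n}. x i \<in> convex hull (x ` I)}" using I(1) by (auto intro: hull_inc)
  next
    fix i assume i: "i \<in> {i\<in>{..<n}. x i \<in> convex hull (x ` I)}"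
    then have "?f (x i) = 0" by (simp add: eq[symmetric])
    then show "i \<in> I" using s(2)[of i] i by fastforce
  qed
  have indep: "inj_on x B" "\<not> affine_dependent (x ` B)"
    using indep_edge_list_iff[OF d B(2) xB] B(3) by auto
  have "x i \<in> affine hull (x ` B)" if "i \<in> I" for i
    by (rule affine_hull_of_side_eq_0[OF d B(2) xB B(3) _ zero[OF that]]) (use I x that in auto)
  then have "affine hull (x ` I) \<subseteq> affine hull (x ` B)"
    by (intro hull_minimal) auto
  moreover have "affine hull (x ` B) \<subseteq> affine hull (x ` I)"
    by (intro hull_mono image_mono B)
  ultimately have hull: "affine hull (x ` B) = affine hull (convex hull (x ` I))"
    by (simp add: affine_hull_convex_hull)
  have "finite B" "B \<noteq> {}" using B d card_gt_0_iff[of B] by auto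
  then have "affine_dim (convex hull (x ` I)) = int (card (x ` B)) - 1"
    using indep(2) hull by (intro affine_dim_eqI) auto
  then show "affine_dim (convex hull (x ` I)) = int (d - 1)"
    using B d by (simp add: card_image[OF indep(1)] of_nat_diff)
qed

text \<open>
  If two points were strictly on different sides of the hyperplane spanned by a facet, the segment
  between them would meet the hyperplane in a point of the polytope. That point would be in the facet,
  and with it both end points.
\<close>

lemma facet_set_of_face:
  fixes x :: "nat \<Rightarrow> (nat \<Rightarrow>\<^sub>0 real)"
  assumes d: "1 \<le> d" and x: "\<And>i. i < n \<Longrightarrow> x i \<in> coord_space d"
    and F: "F face_of convex hull (x ` {..<n})" and dim: "affine_dim F = int (d - 1)"
  defines "I \<equiv> {i\<in>{..<n}. x i \<in> F}"
  shows "facet_set d n x I" and "F = convex hull (x ` I)"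
proof -
  let ?P = "convex hull (x ` {..<n})"
  have xI: "x ` {..<n} \<inter> F = x ` I" by (auto simp: I_def)
  show FI: "F = convex hull (x ` I)"
    using face_of_convex_hull_finite_eq[OF _ F] by (simp add: xI)
  obtain B' where B': "B' \<subseteq> x ` I" "\<not> affine_dependent B'" "affine hull B' = affine hull (x ` I)"
    "card B' = d"
  proof (rule affine_basis_of_finite)
    show "finite (x ` I)" by (simp add: I_def)
    show "affine_dim (convex hull (x ` I)) = int (d - 1)" using dim FI by simp
  qed (use d in auto)
  have "\<exists>U\<subseteq>I. inj_on x U \<and> B' = x ` U"
    using B'(1) by (simp only: subset_image_inj)
  then obtain B where B: "B \<subseteq> I" "inj_on x B" "B' = x ` B"
    by (elim exE conjE)
  have card: "card B = d" using B'(4) B(3) card_image[OF B(2)] by simp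
  have xB: "x i \<in> coord_space d" if "i \<in> B" for i using that B x by (auto simp: I_def)
  have ind: "indep_list d (edge_list x B)"
    using indep_edge_list_iff[OF d card xB] B B' by auto
  have zero: "side d x B (x i) = 0" if "i \<in> I" for i
    by (rule side_eq_0_of_affine_hull[OF d card xB])
      (use that B B' in \<open>auto intro: hull_inc\<close>)
  have in_F: "p \<in> F" if "p \<in> ?P" "p \<in> affine hull (x ` B)" for p
    by (rule face_of_contains_affine_hull_points[OF F _ _ that])
      (use B card d card_ge_0_finite[of B] in \<open>auto simp: I_def\<close>)
  have coord: "p \<in> coord_space d" if "p \<in> ?P" for p
    using that hull_minimal[of "x ` {..<n}" "coord_space d" convex] x
      subspace_imp_convex[OF subspace_coord_space] by blast
  have P: "x j \<in> ?P" if "j < n" for j using that by (auto intro: hull_inc)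
  have nz: "side d x B (x j) \<noteq> 0" if "j \<in> {..<n} - I" for j
    using that affine_hull_of_side_eq_0[OF d card xB ind, of "x j"] in_F[of "x j"] P[of j] coord
    by (auto simp: I_def)
  have no_cross: False
    if j: "j \<in> {..<n} - I" "0 < side d x B (x j)" and k: "k \<in> {..<n} - I" "side d x B (x k) < 0" for j k
  proof -
    define a b where "a = side d x B (x j)" and "b = - side d x B (x k)"
    have ab: "a > 0" "b > 0" using j k by (auto simp: a_def b_def)
    define u where "u = a / (a + b)"
    have u: "0 < u" "u < 1" using ab by (auto simp: u_def field_simps)
    define p where "p = (1 - u) *\<^sub>R x j + u *\<^sub>R x k"
    have "p \<in> ?P"
      unfolding p_def using u j k P
      by (intro convexD_alt[OF convex_convex_hull]) auto
    moreover have "side d x B p = 0"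
    proof -
      have "side d x B (x k) = - b" by (simp add: b_def)
      then have "side d x B p = (1 - u) * a + u * (- b)"
        by (simp only: p_def side_segment a_def)
      also have "\<dots> = 0" using ab by (simp add: u_def field_simps)
      finally show ?thesis .
    qed
    ultimately have "p \<in> F"
      using in_F affine_hull_of_side_eq_0[OF d card xB ind] coord by blast
    moreover have "x j \<noteq> x k" using j k by auto
    then have "p \<in> open_segment (x j) (x k)" using u by (auto simp: in_segment p_def)
    ultimately have "x j \<in> F"
      using face_ofD[OF F _ P P, of p j k] j k by auto
    then show False using j by (simp add: I_def)
  qed
  have "(\<forall>j\<in>{..<n} - I. 0 < side d x B (x j)) \<or> (\<forall>j\<in>{..<n} - I. side d x B (x j) < 0)"
    using no_cross nz by (meson linorder_neqE_linordered_idom)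
  then show "facet_set d n x I"
    unfolding facet_set_def using B card ind zero by blast
qed

theorem num_faces_eq_card_facet_sets:
  fixes x :: "nat \<Rightarrow> (nat \<Rightarrow>\<^sub>0 real)"
  assumes d: "1 \<le> d" and x: "\<And>i. i < n \<Longrightarrow> x i \<in> coord_space d"
  shows "num_faces (d - 1) (convex hull (x ` {..<n})) = card {I \<in> Pow {..<n}. facet_set d n x I}"
proof -
  let ?h = "\<lambda>I. convex hull (x ` I)"
  have inj: "inj_on ?h {I \<in> Pow {..<n}. facet_set d n x I}"
  proof (rule inj_onI)
    fix I J assume IJ: "I \<in> {I \<in> Pow {..<n}. facet_set d n x I}" "J \<in> {I \<in> Pow {..<n}. facet_set d n x I}"
      and eq: "?h I = ?h J"
    have "{i\<in>{..<n}. x i \<in> ?h I} = I"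
      by (rule convex_hull_facet_set(3)[OF d x]) (use IJ in auto)
    moreover have "{i\<in>{..<n}. x i \<in> ?h J} = J"
      by (rule convex_hull_facet_set(3)[OF d x]) (use IJ in auto)
    ultimately show "I = J" unfolding eq by blast
  qed
  have img: "?h ` {I \<in> Pow {..<n}. facet_set d n x I} =
      {F. F face_of convex hull (x ` {..<n}) \<and> affine_dim F = int (d - 1)}"
  proof (intro equalityI subsetI)
    fix F assume "F \<in> ?h ` {I \<in> Pow {..<n}. facet_set d n x I}"
    then obtain I where "I \<subseteq> {..<n}" "facet_set d n x I" "F = ?h I" by auto
    then show "F \<in> {F. F face_of convex hull (x ` {..<n}) \<and> affine_dim F = int (d - 1)}"
      using convex_hull_facet_set(1,2)[OF d x, where I = I] by auto
  next
    fix F assume "F \<in> {F. F face_of convex hull (x ` {..<n}) \<and> affine_dim F = int (d - 1)}"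
    then have F: "F face_of convex hull (x ` {..<n})" "affine_dim F = int (d - 1)" by auto
    show "F \<in> ?h ` {I \<in> Pow {..<n}. facet_set d n x I}"
      using facet_set_of_face[OF d x F] by (intro image_eqI) auto
  qed
  show ?thesis
    unfolding num_faces_def img[symmetric] by (rule card_image[OF inj])
qed

section \<open>Products of normal distributions\<close>

abbreviation normal_dist :: "real \<Rightarrow> real measure" where
  "normal_dist s \<equiv> density lborel (\<lambda>x. ennreal (normal_density 0 s x))"

lemma product_prob_space_normal: "0 < s \<Longrightarrow> product_prob_space (\<lambda>_. normal_dist s)"
  by (intro product_prob_spaceI prob_space_normal_density)

text \<open>
  A linear functional with coefficients of Euclidean norm \<open>1\<close> maps the product of centred normal
  distributions of equal variance to their common factor. This is all that is used of the rotation
  invariance of the Gaussian measure.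
\<close>

lemma nn_integral_normal_linear:
  fixes a :: "'i \<Rightarrow> real"
  assumes K: "finite K" and s: "0 < s" and a: "(\<Sum>p\<in>K. (a p)\<^sup>2) = 1" and [measurable]: "f \<in> borel_measurable borel"
  shows "(\<integral>\<^sup>+\<omega>. f (\<Sum>p\<in>K. a p * \<omega> p) \<partial>PiM K (\<lambda>_. normal_dist s)) = (\<integral>\<^sup>+t. f t \<partial>normal_dist s)"
proof -
  interpret product_prob_space "\<lambda>_. normal_dist s" K by (rule product_prob_space_normal[OF s])
  let ?P = "PiM K (\<lambda>_. normal_dist s)"
  \<comment> \<open>a coordinate with coefficient \<open>0\<close> contributes a constant, which has no normal density\<close>
  define K' where "K' = {p\<in>K. a p \<noteq> 0}"
  have K': "finite K'" "K' \<noteq> {}" "K' \<subseteq> K"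
  proof -
    show "K' \<noteq> {}"
    proof
      assume "K' = {}"
      then have "(\<Sum>p\<in>K. (a p)\<^sup>2) = 0" by (intro sum.neutral) (auto simp: K'_def)
      then show False using a by simp
    qed
  qed (use K in \<open>auto simp: K'_def\<close>)
  have m[measurable]: "p \<in> K \<Longrightarrow> (\<lambda>\<omega>. \<omega> p) \<in> borel_measurable ?P" for p
    using measurable_component_singleton[of p K "\<lambda>_. normal_dist s"] by simp
  have "P.indep_vars (\<lambda>_. normal_dist s) (\<lambda>p \<omega>. \<omega> p) K"
  proof (subst P.indep_vars_iff_distr_eq_PiM')
    have "distr ?P ?P (\<lambda>\<omega>. \<lambda>i\<in>K. \<omega> i) = ?P"
      using distr_PiM_restrict_finite[of K] K by simp
    also have "\<dots> = PiM K (\<lambda>i. distr ?P (normal_dist s) (\<lambda>\<omega>. \<omega> i))"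
      by (intro PiM_cong refl) (simp add: PiM_component)
    finally show "distr ?P ?P (\<lambda>\<omega>. \<lambda>i\<in>K. \<omega> i) = PiM K (\<lambda>i. distr ?P (normal_dist s) (\<lambda>\<omega>. \<omega> i))" .
  qed (use K' in auto)
  then have "P.indep_vars (\<lambda>_. borel) (\<lambda>p \<omega>. a p * \<omega> p) K"
    by (rule P.indep_vars_compose2) auto
  then have ind: "P.indep_vars (\<lambda>_. borel) (\<lambda>p \<omega>. a p * \<omega> p) K'"
    by (rule P.indep_vars_subset) (use K' in auto)
  have dist: "distributed ?P lborel (\<lambda>\<omega>. a p * \<omega> p) (normal_density 0 (\<bar>a p\<bar> * s))" if "p \<in> K'" for p
  proof -
    have p: "p \<in> K" "a p \<noteq> 0" using that by (auto simp: K'_def)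
    have "distr ?P lborel (\<lambda>\<omega>. \<omega> p) = distr ?P (normal_dist s) (\<lambda>\<omega>. \<omega> p)"
      by (rule distr_cong) auto
    also have "\<dots> = normal_dist s" using p by (simp add: PiM_component)
    finally have "distributed ?P lborel (\<lambda>\<omega>. \<omega> p) (normal_density 0 s)"
      using p by (auto simp: distributed_def)
    from P.normal_density_affine[OF this s p(2), of 0] show ?thesis by simp
  qed
  have "sqrt (\<Sum>p\<in>K'. (\<bar>a p\<bar> * s)\<^sup>2) = s"
  proof -
    have "(\<Sum>p\<in>K'. (\<bar>a p\<bar> * s)\<^sup>2) = (\<Sum>p\<in>K'. (a p)\<^sup>2) * s\<^sup>2"
      by (simp add: power_mult_distrib sum_distrib_right)
    also have "(\<Sum>p\<in>K'. (a p)\<^sup>2) = (\<Sum>p\<in>K. (a p)\<^sup>2)"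
      using K by (intro sum.mono_neutral_left) (auto simp: K'_def)
    finally show ?thesis using a s by simp
  qed
  then have "distributed ?P lborel (\<lambda>\<omega>. \<Sum>p\<in>K'. a p * \<omega> p) (normal_density 0 s)"
    using P.sum_indep_normal[OF K'(1,2) ind _ dist] s by (simp add: K'_def)
  then have "distr ?P lborel (\<lambda>\<omega>. \<Sum>p\<in>K'. a p * \<omega> p) = normal_dist s"
    by (rule distributed_distr_eq_density)
  moreover have "(\<Sum>p\<in>K'. a p * \<omega> p) = (\<Sum>p\<in>K. a p * \<omega> p)" for \<omega>
    using K by (intro sum.mono_neutral_left) (auto simp: K'_def)
  ultimately have "distr ?P lborel (\<lambda>\<omega>. \<Sum>p\<in>K. a p * \<omega> p) = normal_dist s" by simp
  then have "(\<integral>\<^sup>+t. f t \<partial>normal_dist s) = (\<integral>\<^sup>+t. f t \<partial>distr ?P lborel (\<lambda>\<omega>. \<Sum>p\<in>K. a p * \<omega> p))"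
    by simp
  also have "\<dots> = (\<integral>\<^sup>+\<omega>. f (\<Sum>p\<in>K. a p * \<omega> p) \<partial>?P)"
    by (rule nn_integral_distr) simp_all
  finally show ?thesis ..
qed

lemma PiM_normal_eq_density:
  fixes K :: "'i set"
  assumes K: "finite K" and s: "0 < s"
  shows "PiM K (\<lambda>_. normal_dist s) =
    density (PiM K (\<lambda>_. lborel)) (\<lambda>\<omega>. \<Prod>p\<in>K. ennreal (normal_density 0 s (\<omega> p)))"
proof -
  interpret N: product_prob_space "\<lambda>_. normal_dist s" K by (rule product_prob_space_normal[OF s])
  interpret L: product_sigma_finite "\<lambda>_ :: 'i. lborel :: real measure" ..
  have "density (PiM K (\<lambda>_. lborel)) (\<lambda>\<omega>. \<Prod>p\<in>K. ennreal (normal_density 0 s (\<omega> p))) = PiM K (\<lambda>_. normal_dist s)"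
  proof (rule N.PiM_eqI[OF K])
    show "sets (density (PiM K (\<lambda>_. lborel)) (\<lambda>\<omega>. \<Prod>p\<in>K. ennreal (normal_density 0 s (\<omega> p)))) =
        sets (PiM K (\<lambda>_. normal_dist s))"
      by (simp cong: sets_PiM_cong)
    fix A :: "'i \<Rightarrow> real set" assume A: "\<And>i. i \<in> K \<Longrightarrow> A i \<in> sets (normal_dist s)"
    then have A': "\<And>i. i \<in> K \<Longrightarrow> A i \<in> sets borel" by simp
    have "emeasure (density (PiM K (\<lambda>_. lborel)) (\<lambda>\<omega>. \<Prod>p\<in>K. ennreal (normal_density 0 s (\<omega> p)))) (Pi\<^sub>E K A) =
      (\<integral>\<^sup>+\<omega>. (\<Prod>p\<in>K. ennreal (normal_density 0 s (\<omega> p))) * indicator (Pi\<^sub>E K A) \<omega> \<partial>PiM K (\<lambda>_. lborel))"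
      by (rule emeasure_density) (use A' K in \<open>auto intro!: sets_PiM_I_finite\<close>)
    also have "\<dots> = (\<integral>\<^sup>+\<omega>. (\<Prod>p\<in>K. ennreal (normal_density 0 s (\<omega> p)) * indicator (A p) (\<omega> p)) \<partial>PiM K (\<lambda>_. lborel))"
    proof (intro nn_integral_cong)
      fix \<omega> :: "'i \<Rightarrow> real" assume "\<omega> \<in> space (PiM K (\<lambda>_. lborel))"
      then have "indicator (Pi\<^sub>E K A) \<omega> = (\<Prod>p\<in>K. indicator (A p) (\<omega> p) :: ennreal)"
        using K by (auto simp: indicator_def space_PiM PiE_iff prod_zero_iff)
      then show "(\<Prod>p\<in>K. ennreal (normal_density 0 s (\<omega> p))) * indicator (Pi\<^sub>E K A) \<omega> =
          (\<Prod>p\<in>K. ennreal (normal_density 0 s (\<omega> p)) * indicator (A p) (\<omega> p))"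
        by (simp add: prod.distrib)
    qed
    also have "\<dots> = (\<Prod>p\<in>K. \<integral>\<^sup>+t. ennreal (normal_density 0 s t) * indicator (A p) t \<partial>lborel)"
      using A' K by (intro L.product_nn_integral_prod) auto
    also have "\<dots> = (\<Prod>p\<in>K. emeasure (normal_dist s) (A p))"
      using A' by (intro prod.cong refl emeasure_density[symmetric]) auto
    finally show "emeasure (density (PiM K (\<lambda>_. lborel)) (\<lambda>\<omega>. \<Prod>p\<in>K. ennreal (normal_density 0 s (\<omega> p)))) (Pi\<^sub>E K A) =
      (\<Prod>p\<in>K. emeasure (normal_dist s) (A p))" .
  qed
  then show ?thesis ..
qed

lemma nn_integral_PiM_normal:
  assumes "finite K" "0 < s" and [measurable]: "f \<in> borel_measurable (PiM K (\<lambda>_. lborel))"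
  shows "(\<integral>\<^sup>+\<omega>. f \<omega> \<partial>PiM K (\<lambda>_. normal_dist s)) =
    (\<integral>\<^sup>+\<omega>. (\<Prod>p\<in>K. ennreal (normal_density 0 s (\<omega> p))) * f \<omega> \<partial>PiM K (\<lambda>_. lborel))"
  unfolding PiM_normal_eq_density[OF assms(1,2)] by (rule nn_integral_density) auto

lemma nn_integral_normal_reflect:
  assumes [measurable]: "f \<in> borel_measurable borel"
  shows "(\<integral>\<^sup>+t. f (- t) \<partial>normal_dist s) = (\<integral>\<^sup>+t. f t \<partial>normal_dist s)"
proof -
  have "(\<integral>\<^sup>+t. f t \<partial>normal_dist s) = (\<integral>\<^sup>+t. ennreal (normal_density 0 s t) * f t \<partial>lborel)"
    by (rule nn_integral_density) auto
  also have "\<dots> = (\<integral>\<^sup>+t. ennreal (normal_density 0 s (- t)) * f (- t) \<partial>lborel)"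
    using nn_integral_real_affine[of "\<lambda>t. ennreal (normal_density 0 s t) * f t" "-1" 0] by simp
  also have "\<dots> = (\<integral>\<^sup>+t. f (- t) \<partial>normal_dist s)"
    by (subst nn_integral_density) (auto simp: normal_density_def)
  finally show ?thesis ..
qed

lemma nn_integral_PiM_lborel_shift:
  fixes K :: "'i set" and c :: "'i \<Rightarrow> real"
  assumes K: "finite K" and f[measurable]: "f \<in> borel_measurable (PiM K (\<lambda>_. lborel))"
  shows "(\<integral>\<^sup>+\<omega>. f (\<lambda>p\<in>K. \<omega> p + c p) \<partial>PiM K (\<lambda>_. lborel)) = (\<integral>\<^sup>+\<omega>. f \<omega> \<partial>PiM K (\<lambda>_. lborel))"
proof -
  interpret L: product_sigma_finite "\<lambda>_ :: 'i. lborel :: real measure" ..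
  let ?L = "PiM K (\<lambda>_. lborel) :: ('i \<Rightarrow> real) measure"
  let ?T = "\<lambda>\<omega>. \<lambda>p\<in>K. \<omega> p + c p"
  have T[measurable]: "?T \<in> measurable ?L ?L" by measurable
  have "distr ?L ?L ?T = ?L"
  proof (rule L.PiM_eqI[OF K])
    fix A :: "'i \<Rightarrow> real set" assume A: "\<And>i. i \<in> K \<Longrightarrow> A i \<in> sets lborel"
    have "?T -` Pi\<^sub>E K A \<inter> space ?L = Pi\<^sub>E K (\<lambda>p. (\<lambda>x. x + c p) -` A p)"
      by (auto simp: space_PiM PiE_iff)
    then have "emeasure (distr ?L ?L ?T) (Pi\<^sub>E K A) = emeasure ?L (Pi\<^sub>E K (\<lambda>p. (\<lambda>x. x + c p) -` A p))"
      by (subst emeasure_distr) (use A K in \<open>auto intro!: sets_PiM_I_finite\<close>)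
    also have "\<dots> = (\<Prod>p\<in>K. emeasure lborel ((\<lambda>x. x + c p) -` A p))"
      using A by (intro L.emeasure_PiM[OF K]) (auto intro: measurable_sets_borel[of _ borel])
    also have "\<dots> = (\<Prod>p\<in>K. emeasure lborel (A p))"
    proof (intro prod.cong refl)
      fix p assume p: "p \<in> K"
      have "emeasure lborel (A p) = emeasure (distr lborel borel ((+) (c p))) (A p)"
        by (simp add: lborel_distr_plus)
      also have "\<dots> = emeasure lborel ((\<lambda>x. x + c p) -` A p)"
      proof -
        have "(+) (c p) = (\<lambda>x. x + c p)" by (simp add: fun_eq_iff)
        then show ?thesis using A[OF p] by (subst emeasure_distr) auto
      qed
      finally show "emeasure lborel ((\<lambda>x. x + c p) -` A p) = emeasure lborel (A p)" ..
    qed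
    finally show "emeasure (distr ?L ?L ?T) (Pi\<^sub>E K A) = (\<Prod>p\<in>K. emeasure lborel (A p))" .
  qed simp
  then have "(\<integral>\<^sup>+\<omega>. f \<omega> \<partial>?L) = (\<integral>\<^sup>+\<omega>. f \<omega> \<partial>distr ?L ?L ?T)" by simp
  also have "\<dots> = (\<integral>\<^sup>+\<omega>. f (?T \<omega>) \<partial>?L)" by (rule nn_integral_distr) simp_all
  finally show ?thesis ..
qed

lemma sum_row: "(\<Sum>p\<in>{j} \<times> D. h p) = (\<Sum>k\<in>D. h (j, k))"
proof -
  have "{j} \<times> D = Pair j ` D" by auto
  then show ?thesis by (simp add: sum.reindex inj_on_def)
qed

lemma nn_integral_normal_rows:
  fixes v :: "'b \<Rightarrow> real" and J :: "'a set"
  assumes J: "finite J" and D: "finite D" and v: "(\<Sum>k\<in>D. (v k)\<^sup>2) = 1" and s: "0 < s"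
    and g[measurable]: "g \<in> borel_measurable borel"
  shows "(\<integral>\<^sup>+\<omega>. (\<Prod>j\<in>J. g (\<Sum>k\<in>D. v k * \<omega> (j, k))) \<partial>PiM (J \<times> D) (\<lambda>_. normal_dist s)) =
    (\<integral>\<^sup>+t. g t \<partial>normal_dist s) ^ card J"
  using J
proof induction
  case empty
  interpret product_prob_space "\<lambda>_. normal_dist s" "{}" by (rule product_prob_space_normal[OF s])
  show ?case by (simp add: P.emeasure_space_1 del: space_PiM_empty)
next
  case (insert j J)
  interpret product_prob_space "\<lambda>_. normal_dist s" "insert j J \<times> D" by (rule product_prob_space_normal[OF s])
  let ?N = "\<lambda>K. PiM K (\<lambda>_. normal_dist s)"
  have comp[measurable]: "p \<in> K \<Longrightarrow> (\<lambda>\<omega>. \<omega> p) \<in> borel_measurable (?N K)" for p and K :: "('a \<times> 'b) set"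
    using measurable_component_singleton[of p K "\<lambda>_. normal_dist s"] by simp
  have dec: "insert j J \<times> D = ({j} \<times> D) \<union> (J \<times> D)" by auto
  have row: "(\<integral>\<^sup>+x. g (\<Sum>k\<in>D. v k * x (j, k)) \<partial>?N ({j} \<times> D)) = (\<integral>\<^sup>+t. g t \<partial>normal_dist s)"
    using nn_integral_normal_linear[of "{j} \<times> D" s "\<lambda>p. v (snd p)" g] D s v by (simp add: sum_row)
  have "(\<integral>\<^sup>+\<omega>. (\<Prod>j\<in>insert j J. g (\<Sum>k\<in>D. v k * \<omega> (j, k))) \<partial>?N (insert j J \<times> D)) =
    (\<integral>\<^sup>+x. \<integral>\<^sup>+y. (\<Prod>i\<in>insert j J. g (\<Sum>k\<in>D. v k * merge ({j} \<times> D) (J \<times> D) (x, y) (i, k))) \<partial>?N (J \<times> D) \<partial>?N ({j} \<times> D))"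
    unfolding dec
  proof (rule product_nn_integral_fold)
    show "(\<lambda>\<omega>. \<Prod>j\<in>insert j J. g (\<Sum>k\<in>D. v k * \<omega> (j, k))) \<in> borel_measurable (?N ({j} \<times> D \<union> J \<times> D))"
      by (intro borel_measurable_prod_ennreal measurable_compose[OF _ g] borel_measurable_sum borel_measurable_times comp) auto
  qed (use insert D in auto)
  also have "\<dots> = (\<integral>\<^sup>+x. \<integral>\<^sup>+y. g (\<Sum>k\<in>D. v k * x (j, k)) * (\<Prod>i\<in>J. g (\<Sum>k\<in>D. v k * y (i, k))) \<partial>?N (J \<times> D) \<partial>?N ({j} \<times> D))"
  proof (intro nn_integral_cong)
    fix x y :: "'a \<times> 'b \<Rightarrow> real"
    have "(\<Sum>k\<in>D. v k * merge ({j} \<times> D) (J \<times> D) (x, y) (j, k)) = (\<Sum>k\<in>D. v k * x (j, k))"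
      by (intro sum.cong) (auto simp: merge_def)
    moreover have "(\<Sum>k\<in>D. v k * merge ({j} \<times> D) (J \<times> D) (x, y) (i, k)) = (\<Sum>k\<in>D. v k * y (i, k))" if "i \<in> J" for i
      using that insert by (intro sum.cong) (auto simp: merge_def)
    ultimately show "(\<Prod>i\<in>insert j J. g (\<Sum>k\<in>D. v k * merge ({j} \<times> D) (J \<times> D) (x, y) (i, k))) =
        g (\<Sum>k\<in>D. v k * x (j, k)) * (\<Prod>i\<in>J. g (\<Sum>k\<in>D. v k * y (i, k)))"
      using insert by simp
  qed
  also have "\<dots> = (\<integral>\<^sup>+x. g (\<Sum>k\<in>D. v k * x (j, k)) * (\<integral>\<^sup>+t. g t \<partial>normal_dist s) ^ card J \<partial>?N ({j} \<times> D))"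
    unfolding insert.IH[symmetric]
    by (intro nn_integral_cong nn_integral_cmult borel_measurable_prod_ennreal measurable_compose[OF _ g] borel_measurable_sum borel_measurable_times comp) auto
  also have "\<dots> = (\<integral>\<^sup>+x. g (\<Sum>k\<in>D. v k * x (j, k)) \<partial>?N ({j} \<times> D)) * (\<integral>\<^sup>+t. g t \<partial>normal_dist s) ^ card J"
    by (intro nn_integral_multc measurable_compose[OF _ g] borel_measurable_sum borel_measurable_times comp) auto
  finally show ?case using insert by (simp add: row)
qed

section \<open>The normal distribution function\<close>

definition normal_cdf :: "real \<Rightarrow> real" where
  "normal_cdf x = measure (normal_dist 1) {..x}"

text \<open>
  This number is the logarithmic derivative of the distribution function at \<open>0\<close>, and also the mean of
  the absolute value of a standard normal variable.
\<close>

abbreviation cdf_slope :: real where "cdf_slope \<equiv> sqrt (2 / pi)"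

interpretation stdn: prob_space "normal_dist 1"
  by (rule prob_space_normal_density) simp

lemma emeasure_normal_atMost:
  "emeasure (normal_dist 1) {..x} = ennreal (normal_cdf x)"
  by (simp add: normal_cdf_def stdn.emeasure_eq_measure)

lemma normal_cdf_minus: "normal_cdf (- x) = 1 - normal_cdf x"
proof -
  let ?M = "normal_dist 1"
  have "emeasure ?M {..- x} = (\<integral>\<^sup>+t. ennreal (std_normal_density t) * indicator {..- x} t \<partial>lborel)"
    by (subst emeasure_density) auto
  also have "\<dots> = (\<integral>\<^sup>+t. ennreal (std_normal_density (- t)) * indicator {..- x} (- t) \<partial>lborel)"
    using nn_integral_real_affine[of "\<lambda>t. ennreal (std_normal_density t) * indicator {..- x} t" "-1" 0]
    by simp
  also have "\<dots> = (\<integral>\<^sup>+t. ennreal (std_normal_density t) * indicator {x<..} t \<partial>lborel)"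
    by (rule nn_integral_cong_AE, use AE_lborel_singleton[of x] in eventually_elim)
      (auto simp: normal_density_def indicator_def)
  also have "\<dots> = emeasure ?M {x<..}"
    by (subst emeasure_density) auto
  also have "{x<..} = UNIV - {..x}" by auto
  finally have "emeasure ?M {..- x} = emeasure ?M (UNIV - {..x})" .
  then have "measure ?M {..- x} = measure ?M (UNIV - {..x})" by (simp add: measure_def)
  also have "\<dots> = 1 - measure ?M {..x}"
    using stdn.prob_compl[of "{..x}"] by simp
  finally show ?thesis by (simp add: normal_cdf_def)
qed

lemma normal_cdf_diff: "a \<le> b \<Longrightarrow> normal_cdf b - normal_cdf a = integral {a..b} std_normal_density"
proof -
  assume ab: "a \<le> b"
  let ?M = "normal_dist 1"
  have "normal_cdf b - normal_cdf a = measure ?M ({..b} - {..a})"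
    using ab unfolding normal_cdf_def by (subst stdn.finite_measure_Diff) auto
  also have "{..b} - {..a} = {a<..b}" by auto
  also have "measure ?M {a<..b} = measure ?M {a..b}"
  proof -
    have "emeasure ?M {a} = 0"
      by (subst emeasure_density) (auto simp: nn_integral_indicator_singleton)
    then have "measure ?M ({a} \<union> {a<..b}) = measure ?M {a<..b}"
      by (subst stdn.finite_measure_Union) (auto simp: measure_def)
    moreover have "{a} \<union> {a<..b} = {a..b}" using ab by auto
    ultimately show ?thesis by simp
  qed
  also have "\<dots> = integral {a..b} std_normal_density"
  proof -
    have c: "continuous_on {a..b} std_normal_density"
      by (auto simp: normal_density_def intro!: continuous_intros)
    have "emeasure ?M {a..b} = (\<integral>\<^sup>+x. ennreal (std_normal_density x) * indicator {a..b} x \<partial>lborel)"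
      by (subst emeasure_density) auto
    also have "\<dots> = ennreal (integral {a..b} std_normal_density)"
      using nn_integral_has_integral_lebesgue[of "{a..b}" std_normal_density "integral {a..b} std_normal_density"]
       integrable_integral[OF integrable_continuous_interval[OF c]]
      by (simp add: normal_density_nonneg nn_integral_set_ennreal mult.commute)
    finally show ?thesis 
      by (simp add: measure_def integral_nonneg integrable_continuous_interval[OF c])
  qed
  finally show ?thesis .
qed

lemma normal_cdf_deriv: "(normal_cdf has_real_derivative std_normal_density x) (at x)"
proof -
  have c: "continuous_on {x - 1..x + 1} std_normal_density"
    by (auto simp: normal_density_def intro!: continuous_intros)
  have "((\<lambda>u. integral {x - 1..u} std_normal_density) has_real_derivative std_normal_density x)
      (at x within {x - 1..x + 1})"
    by (rule integral_has_real_derivative[OF c]) simp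
  then have "((\<lambda>u. normal_cdf (x - 1) + integral {x - 1..u} std_normal_density) has_real_derivative std_normal_density x)
      (at x within {x - 1..x + 1})"
    by (auto intro!: derivative_eq_intros)
  then have "(normal_cdf has_real_derivative std_normal_density x) (at x within {x - 1..x + 1})"
    by (rule has_field_derivative_transform_within[of _ _ _ _ 1]) (auto simp: normal_cdf_diff[symmetric])
  then show ?thesis
    by (simp add: at_within_Icc_at)
qed

lemma normal_cdf_half: "normal_cdf 0 = 1 / 2"
  using normal_cdf_minus[of 0] by simp

lemma normal_cdf_at_bot: "(normal_cdf \<longlongrightarrow> 0) at_bot"
  unfolding normal_cdf_def
proof -
  interpret real_distribution "normal_dist 1"
    by (rule real_dist_normal_dist) 
  show "((\<lambda>x. measure (normal_dist 1) {..x}) \<longlongrightarrow> 0) at_bot"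
    using cdf_lim_at_bot by (simp add: cdf_def)
qed

lemma normal_cdf_nonneg: "0 \<le> normal_cdf x" by (simp add: normal_cdf_def)

text \<open>
  The tangent at \<open>0\<close> lies above the concave function \<open>ln (2 \<Phi>)\<close>. The proof avoids second derivatives: the
  difference of the two sides has derivative \<open>b (exp (b x) - exp (- x\<^sup>2 / 2))\<close>, which changes sign at
  \<open>-2b\<close> and at \<open>0\<close>, so the difference rises from its limit \<open>0\<close> at minus infinity, falls to the value
  \<open>0\<close> at \<open>0\<close>, and rises again.
\<close>

lemma normal_cdf_upper: "2 * normal_cdf x \<le> exp (cdf_slope * x)"
proof -
  define p where "p x = exp (cdf_slope * x) - 2 * normal_cdf x" for x
  define p' where "p' x = cdf_slope * (exp (cdf_slope * x) - exp (- x\<^sup>2 / 2))" for x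
  have slope_eq: "2 / sqrt (2 * pi) = cdf_slope"
    by (simp add: real_sqrt_divide real_sqrt_mult field_simps)
  have deriv: "(p has_real_derivative p' x) (at x)" for x
    unfolding p_def p'_def
    by (rule derivative_eq_intros normal_cdf_deriv refl)+
      (simp add: normal_density_def slope_eq[symmetric] field_simps)
  have p0: "p 0 = 0" by (simp add: p_def normal_cdf_half)
  have lim: "(p \<longlongrightarrow> 0) at_bot"
  proof -
    have "((\<lambda>x. exp (cdf_slope * x)) \<longlongrightarrow> 0) at_bot"
      by (intro filterlim_compose[OF exp_at_bot] filterlim_tendsto_pos_mult_at_bot[OF tendsto_const]) 
         (auto simp: filterlim_ident)
    from tendsto_diff[OF this tendsto_mult[OF tendsto_const normal_cdf_at_bot, of 2]] show ?thesis
      by (simp add: p_def[abs_def])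
  qed
  have "0 \<le> p x"
  proof (cases "x \<ge> 0")
    case True
    have "p 0 \<le> p x"
    proof (rule DERIV_nonneg_imp_nondecreasing[OF True])
      fix y :: real assume "0 \<le> y"
      then have "0 \<le> cdf_slope * y" by (intro mult_nonneg_nonneg) auto
      moreover have "- y\<^sup>2 / 2 \<le> 0" by simp
      ultimately have "- y\<^sup>2 / 2 \<le> cdf_slope * y" by linarith
      then have "0 \<le> p' y" by (auto simp: p'_def)
      then show "\<exists>z. (p has_real_derivative z) (at y) \<and> 0 \<le> z" using deriv by blast
    qed
    then show ?thesis by (simp add: p0)
  next
    case neg: False
    show ?thesis
    proof (cases "x \<ge> - 2 * cdf_slope")
      case True
      have "x \<le> 0" using neg by simp
      then have "p 0 \<le> p x"
      proof (rule DERIV_nonpos_imp_nonincreasing)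
        fix y assume y: "x \<le> y" "y \<le> 0"
        have "cdf_slope * y \<le> - y\<^sup>2 / 2"
        proof -
          have "0 \<le> (- y) * (y + 2 * cdf_slope)" using y True by (intro mult_nonneg_nonneg) auto
          then show ?thesis by (simp add: power2_eq_square algebra_simps)
        qed
        then have "p' y \<le> 0" by (auto simp: p'_def mult_le_0_iff)
        then show "\<exists>z. (p has_real_derivative z) (at y) \<and> z \<le> 0" using deriv by blast
      qed
      then show ?thesis by (simp add: p0)
    next
      case False
      have "p y \<le> p x" if "y \<le> x" for y
      proof (rule DERIV_nonneg_imp_nondecreasing[OF that])
        fix z assume z: "y \<le> z" "z \<le> x"
        have "- z\<^sup>2 / 2 \<le> cdf_slope * z"
        proof -
          have "0 \<le> (- z) * (- (z + 2 * cdf_slope))" using z neg False by (intro mult_nonneg_nonneg) auto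
          then show ?thesis by (simp add: power2_eq_square algebra_simps)
        qed
        then have "0 \<le> p' z" by (auto simp: p'_def)
        then show "\<exists>y. (p has_real_derivative y) (at z) \<and> 0 \<le> y" using deriv by blast
      qed
      then have "eventually (\<lambda>y. p y \<le> p x) at_bot"
        using eventually_le_at_bot[of x] by (rule eventually_mono[rotated]) auto
      from tendsto_upperbound[OF lim this] show ?thesis by simp
    qed
  qed
  then show ?thesis by (simp add: p_def)
qed

text \<open>
  For a standard normal \<open>N\<close>, a shift of the integration variable gives
  \<open>2 \<Phi>(x) exp (x\<^sup>2/2) = E exp (x \<bar>N\<bar>)\<close>, and by Jensen's inequality this is at least \<open>exp (x E \<bar>N\<bar>)\<close>.
  Jensen's inequality for the exponential is the tangent inequality \<open>1 + X \<le> exp X\<close> at the mean, and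
  this becomes an inequality between derivatives: \<open>q\<close> below is the difference of antiderivatives that
  vanish at minus infinity, and \<open>s = x\<close> is the point at which the claim is read off.
\<close>

lemma normal_cdf_lower: "exp (cdf_slope * x - x\<^sup>2 / 2) \<le> 2 * normal_cdf x"
proof -
  define K where "K = exp (cdf_slope * x - x\<^sup>2 / 2)"
  define q where "q s = normal_cdf s - K * ((1 - cdf_slope * x) * normal_cdf (s - x) + x * std_normal_density (s - x))" for s
  have phi0: "std_normal_density 0 = cdf_slope / 2"
    by (simp add: std_normal_density_def real_sqrt_divide real_sqrt_mult field_simps)
  have phi': "((\<lambda>s. std_normal_density (s - x)) has_real_derivative
      - (s - x) * std_normal_density (s - x)) (at s)" for s
  proof -
    define k where "k = 1 / sqrt (2 * pi)"
    have "((\<lambda>s. k * exp (- (s - x)\<^sup>2 / 2)) has_real_derivative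
      - (s - x) * (k * exp (- (s - x)\<^sup>2 / 2))) (at s)"
      by (rule derivative_eq_intros refl | simp add: field_simps)+
    then show ?thesis
      by (simp add: std_normal_density_def k_def)
  qed
  have normal_cdf': "((\<lambda>s. normal_cdf (s - x)) has_real_derivative std_normal_density (s - x)) (at s)" for s
    by (rule DERIV_chain'[OF _ normal_cdf_deriv, of _ 1, simplified]) (auto intro!: derivative_eq_intros)
  define q' where "q' s = std_normal_density s - K * std_normal_density (s - x) * (1 - x * (s - x) - cdf_slope * x)" for s
  have deriv: "(q has_real_derivative q' s) (at s)" for s
    unfolding q_def q'_def
    by (rule derivative_eq_intros normal_cdf_deriv normal_cdf' phi' refl)+ (simp add: algebra_simps)
  have nonneg: "0 \<le> q' s" for s
  proof -
    define X where "X = - x * (s - x) - cdf_slope * x"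
    have "K * std_normal_density (s - x) * (1 + X) \<le> K * std_normal_density (s - x) * exp X"
      by (intro mult_left_mono exp_ge_add_one_self) (auto simp: K_def)
    also have "\<dots> = std_normal_density s"
      by (simp add: K_def std_normal_density_def X_def exp_add[symmetric] field_simps power2_eq_square)
    finally show ?thesis by (simp add: q'_def X_def algebra_simps)
  qed
  have lim: "(q \<longlongrightarrow> 0) at_bot"
  proof -
    have shift: "LIM s at_bot. s - x :> at_bot" by real_asymp
    have "((\<lambda>s. std_normal_density (s - x)) \<longlongrightarrow> 0) at_bot"
      unfolding std_normal_density_def by real_asymp
    then have "(q \<longlongrightarrow> 0 - K * ((1 - cdf_slope * x) * 0 + x * 0)) at_bot"
      unfolding q_def by (intro tendsto_intros normal_cdf_at_bot filterlim_compose[OF normal_cdf_at_bot shift])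
    then show ?thesis by simp
  qed
  have "q y \<le> q x" if "y \<le> x" for y
    by (rule DERIV_nonneg_imp_nondecreasing[OF that]) (use deriv nonneg in blast)
  then have "eventually (\<lambda>y. q y \<le> q x) at_bot"
    using eventually_le_at_bot[of x] by (rule eventually_mono[rotated]) auto
  from tendsto_upperbound[OF lim this] have "0 \<le> q x" by simp
  then show ?thesis
    by (simp add: q_def K_def phi0 normal_cdf_half algebra_simps)
qed

text \<open>
  Completing the square turns the integrand into a multiple of the normal density with variance
  \<open>1/e\<close>. The coefficient of \<open>t\<^sup>2\<close> is written as a difference so that \<open>e\<close> is the new precision.
\<close>

lemma nn_integral_normal_exp_quadratic:
  fixes a e c :: real
  assumes "0 < a" "0 < e"
  shows "(\<integral>\<^sup>+t. ennreal (exp (c * t - (e - a) * t\<^sup>2 / 2))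
            \<partial>normal_dist (1 / sqrt a)) =
         ennreal (sqrt (a / e) * exp (c\<^sup>2 / (2 * e)))"
proof -
  have eq: "normal_density 0 (1 / sqrt a) t * exp (c * t - (e - a) * t\<^sup>2 / 2) =
     sqrt (a / e) * exp (c\<^sup>2 / (2 * e)) * normal_density (c / e) (1 / sqrt e) t" for t
  proof -
    have "normal_density 0 (1 / sqrt a) t * exp (c * t - (e - a) * t\<^sup>2 / 2) =
       sqrt (a / (2 * pi)) * exp (- (a * t\<^sup>2 / 2) + (c * t - (e - a) * t\<^sup>2 / 2))"
    proof -
      have "normal_density 0 (1 / sqrt a) t = sqrt (a / (2 * pi)) * exp (- (a * t\<^sup>2 / 2))"
        using assms by (simp add: normal_density_def power_divide real_sqrt_divide real_sqrt_mult)
      then show ?thesis by (simp only: exp_add mult.assoc)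
    qed
    also have "- (a * t\<^sup>2 / 2) + (c * t - (e - a) * t\<^sup>2 / 2) = c\<^sup>2 / (2 * e) + (- (e * (t - c / e)\<^sup>2 / 2))"
      using assms by (simp add: field_simps power2_eq_square)
    also have "sqrt (a / (2 * pi)) = sqrt (a / e) * sqrt (e / (2 * pi))"
      using assms by (simp add: real_sqrt_mult[symmetric])
    also have "sqrt (a / e) * sqrt (e / (2 * pi)) * exp (c\<^sup>2 / (2 * e) + (- (e * (t - c / e)\<^sup>2 / 2))) =
       sqrt (a / e) * exp (c\<^sup>2 / (2 * e)) * (sqrt (e / (2 * pi)) * exp (- (e * (t - c / e)\<^sup>2 / 2)))"
      by (simp only: exp_add mult_ac)
    also have "sqrt (e / (2 * pi)) * exp (- (e * (t - c / e)\<^sup>2 / 2)) = normal_density (c / e) (1 / sqrt e) t"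
      using assms by (simp add: normal_density_def power_divide real_sqrt_divide real_sqrt_mult mult.commute)
    finally show ?thesis .
  qed
  have "(\<integral>\<^sup>+t. ennreal (exp (c * t - (e - a) * t\<^sup>2 / 2))
            \<partial>normal_dist (1 / sqrt a)) =
     (\<integral>\<^sup>+t. ennreal (sqrt (a / e) * exp (c\<^sup>2 / (2 * e))) * ennreal (normal_density (c / e) (1 / sqrt e) t) \<partial>lborel)"
    using assms by (subst nn_integral_density) (auto simp: ennreal_mult[symmetric] eq)
  also have "\<dots> = ennreal (sqrt (a / e) * exp (c\<^sup>2 / (2 * e))) *
      emeasure (density lborel (\<lambda>x. ennreal (normal_density (c / e) (1 / sqrt e) x))) UNIV"
    by (subst nn_integral_cmult, simp, subst emeasure_density) auto
  also have "emeasure (density lborel (\<lambda>x. ennreal (normal_density (c / e) (1 / sqrt e) x))) UNIV = 1"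
    using prob_space.emeasure_space_1[OF prob_space_normal_density[of "1 / sqrt e" "c / e"]] assms by simp
  finally show ?thesis by simp
qed

lemma nn_integral_normal_cdf_power_bounds:
  fixes d m :: nat
  assumes d: "d \<ge> 1"
  defines "J \<equiv> \<integral>\<^sup>+t. ennreal ((2 * normal_cdf t) ^ m)
             \<partial>normal_dist (1 / sqrt (real d))"
  shows "J \<le> ennreal (exp (real m ^ 2 / (pi * real d)))" (is ?upper)
    and "ennreal (exp (real m ^ 2 / (pi * real d) - real m ^ 3 / (pi * real d ^ 2) - real m / (2 * real d))) \<le> J"
      (is ?lower)
proof -
  have c2: "(real m * cdf_slope)\<^sup>2 = 2 * real m ^ 2 / pi" by (simp add: power_mult_distrib)
  have "J \<le> (\<integral>\<^sup>+t. ennreal (exp (real m * cdf_slope * t - (real d - real d) * t\<^sup>2 / 2))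
             \<partial>normal_dist (1 / sqrt (real d)))"
    unfolding J_def
  proof (intro nn_integral_mono ennreal_leI)
    fix t
    have "(2 * normal_cdf t) ^ m \<le> exp (cdf_slope * t) ^ m"
      by (intro power_mono normal_cdf_upper) (simp add: normal_cdf_nonneg)
    then show "(2 * normal_cdf t) ^ m \<le> exp (real m * cdf_slope * t - (real d - real d) * t\<^sup>2 / 2)"
      by (simp add: exp_of_nat_mult[symmetric] mult.assoc)
  qed
  also have "\<dots> = ennreal (exp (real m ^ 2 / (pi * real d)))"
    using d by (subst nn_integral_normal_exp_quadratic) (simp_all add: c2 field_simps del: diff_self)
  finally show ?upper .
  have "exp (real m ^ 2 / (pi * real d) - real m ^ 3 / (pi * real d ^ 2) - real m / (2 * real d)) \<le>
     sqrt (real d / (real d + real m)) * exp ((real m * cdf_slope)\<^sup>2 / (2 * (real d + real m)))"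
  proof -
    have "real d + real m \<le> real d * exp (real m / real d)"
      using mult_left_mono[OF exp_ge_add_one_self[of "real m / real d"], of "real d"] d
      by (simp add: algebra_simps)
    then have "exp (- (real m / real d)) \<le> real d / (real d + real m)"
      using d by (simp add: exp_minus field_simps)
    then have "sqrt (exp (- (real m / real d))) \<le> sqrt (real d / (real d + real m))"
      by simp
    moreover have "sqrt (exp (- (real m / real d))) = exp (- (real m / (2 * real d)))"
      by (rule real_sqrt_unique) (auto simp: power2_eq_square exp_add[symmetric])
    ultimately have 1: "exp (- (real m / (2 * real d))) \<le> sqrt (real d / (real d + real m))" by simp
    have "1 / real d - real m / real d ^ 2 \<le> 1 / (real d + real m)"
    proof -
      have "(real d - real m) * (real d + real m) \<le> real d ^ 2" by (simp add: algebra_simps power2_eq_square)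
      then have "(real d - real m) / real d ^ 2 \<le> 1 / (real d + real m)"
        using d by (simp add: divide_simps)
      moreover have "(real d - real m) / real d ^ 2 = 1 / real d - real m / real d ^ 2"
        using d by (simp add: field_simps power2_eq_square)
      ultimately show ?thesis by simp
    qed
    from mult_left_mono[OF this, of "real m ^ 2 / pi"]
    have le: "real m ^ 2 / pi * (1 / real d - real m / real d ^ 2) \<le> real m ^ 2 / pi * (1 / (real d + real m))"
      by simp
    have 2: "real m ^ 2 / (pi * real d) - real m ^ 3 / (pi * real d ^ 2) \<le> (real m * cdf_slope)\<^sup>2 / (2 * (real d + real m))"
    proof -
      have "(real m * cdf_slope)\<^sup>2 / (2 * (real d + real m)) = real m ^ 2 / pi * (1 / (real d + real m))"
        unfolding c2 by (simp add: divide_simps)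
      with le show ?thesis
        by (simp add: right_diff_distrib power2_eq_square power3_eq_cube)
    qed
    have "exp (real m ^ 2 / (pi * real d) - real m ^ 3 / (pi * real d ^ 2) - real m / (2 * real d)) =
      exp (- (real m / (2 * real d))) * exp (real m ^ 2 / (pi * real d) - real m ^ 3 / (pi * real d ^ 2))"
      by (simp add: exp_add[symmetric])
    also have "\<dots> \<le> sqrt (real d / (real d + real m)) * exp ((real m * cdf_slope)\<^sup>2 / (2 * (real d + real m)))"
      using 1 2 by (intro mult_mono) auto
    finally show ?thesis .
  qed
  then have "ennreal (exp (real m ^ 2 / (pi * real d) - real m ^ 3 / (pi * real d ^ 2) - real m / (2 * real d))) \<le>
     ennreal (sqrt (real d / (real d + real m)) * exp ((real m * cdf_slope)\<^sup>2 / (2 * (real d + real m))))"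
    by (rule ennreal_leI)
  also have "\<dots> = (\<integral>\<^sup>+t. ennreal (exp (real m * cdf_slope * t - (real d + real m - real d) * t\<^sup>2 / 2))
             \<partial>normal_dist (1 / sqrt (real d)))"
    using d by (subst nn_integral_normal_exp_quadratic) simp_all
  also have "\<dots> \<le> J"
    unfolding J_def
  proof (intro nn_integral_mono ennreal_leI)
    fix t
    have "exp (cdf_slope * t - t\<^sup>2 / 2) ^ m \<le> (2 * normal_cdf t) ^ m"
      by (intro power_mono normal_cdf_lower) simp
    then show "exp (real m * cdf_slope * t - (real d + real m - real d) * t\<^sup>2 / 2) \<le> (2 * normal_cdf t) ^ m"
      by (simp add: exp_of_nat_mult[symmetric] algebra_simps)
  qed
  finally show ?lower .
qed

section \<open>Measurability of normals\<close>

text \<open>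
  Random vectors enter only through inner products, so measurability of each coordinate suffices and
  no sigma-algebra on the vector space is used.
\<close>

definition coord_measurable :: "'a measure \<Rightarrow> ('a \<Rightarrow> (nat \<Rightarrow>\<^sub>0 real)) \<Rightarrow> bool" where
  "coord_measurable M f \<longleftrightarrow> (\<forall>k. (\<lambda>\<omega>. coord (f \<omega>) k) \<in> borel_measurable M)"

lemma coord_measurableD: "coord_measurable M f \<Longrightarrow> (\<lambda>\<omega>. coord (f \<omega>) k) \<in> borel_measurable M"
  by (simp add: coord_measurable_def)

lemma coord_measurable_ip:
  assumes "coord_measurable M f" "coord_measurable M g"
  shows "(\<lambda>\<omega>. ip d (f \<omega>) (g \<omega>)) \<in> borel_measurable M"
  unfolding ip_def by (intro borel_measurable_sum borel_measurable_times coord_measurableD assms)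

lemma coord_measurable_diff:
  "coord_measurable M f \<Longrightarrow> coord_measurable M g \<Longrightarrow> coord_measurable M (\<lambda>\<omega>. f \<omega> - g \<omega>)"
  by (auto simp: coord_measurable_def lookup_minus intro!: borel_measurable_diff)

lemma coord_measurable_scaleR:
  "r \<in> borel_measurable M \<Longrightarrow> coord_measurable M f \<Longrightarrow> coord_measurable M (\<lambda>\<omega>. r \<omega> *\<^sub>R f \<omega>)"
  by (auto simp: coord_measurable_def coord_scaleR intro!: borel_measurable_times)

lemma coord_measurable_const: "coord_measurable M (\<lambda>\<omega>. v)"
  by (simp add: coord_measurable_def)

lemma coord_measurable_orth_proj:
  assumes "\<And>i. i \<in> set is \<Longrightarrow> coord_measurable M (f i)" "coord_measurable M g"
  shows "coord_measurable M (\<lambda>\<omega>. orth_proj d (map (\<lambda>i. f i \<omega>) is) (g \<omega>))"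
  using assms
proof (induction "is" arbitrary: g)
  case (Cons i "is")
  have "coord_measurable M (\<lambda>\<omega>. orth_proj d (map (\<lambda>i. f i \<omega>) is) (h \<omega>))" if "coord_measurable M h" for h
    using Cons.IH[OF Cons.prems(1) that] by simp
  then show ?case
    using Cons.prems
    by (auto intro!: coord_measurable_diff coord_measurable_scaleR borel_measurable_divide coord_measurable_ip)
qed simp

lemma coord_measurable_unit_normal:
  assumes "\<And>i. i \<in> set is \<Longrightarrow> coord_measurable M (f i)"
  shows "coord_measurable M (\<lambda>\<omega>. unit_normal d (map (\<lambda>i. f i \<omega>) is))"
proof -
  let ?p = "\<lambda>k \<omega>. orth_proj d (map (\<lambda>i. f i \<omega>) is) (unit_vec k)"
  have p: "coord_measurable M (?p k)" for k
    by (intro coord_measurable_orth_proj assms coord_measurable_const)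
  have [measurable]: "(\<lambda>\<omega>. ip d (?p k \<omega>) (?p k \<omega>)) \<in> borel_measurable M" for k
    by (intro coord_measurable_ip p)
  have "coord_measurable M (\<lambda>\<omega>. normal_dir d (map (\<lambda>i. f i \<omega>) is))"
    unfolding coord_measurable_def normal_dir_def
  proof
    fix j
    have "(\<lambda>\<omega>. LEAST k. ip d (?p k \<omega>) (?p k \<omega>) \<noteq> 0) \<in> measurable M (count_space UNIV)"
      by (rule measurable_Least) measurable
    from measurable_compose_countable[of "\<lambda>k \<omega>. coord (?p k \<omega>) j", OF coord_measurableD[OF p] this]
    show "(\<lambda>\<omega>. coord (?p (LEAST k. ip d (?p k \<omega>) (?p k \<omega>) \<noteq> 0) \<omega>) j) \<in> borel_measurable M" .
  qed
  then show ?thesis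
    unfolding unit_normal_def
    by (intro coord_measurable_scaleR borel_measurable_divide borel_measurable_const
        borel_measurable_sqrt[THEN measurable_compose[rotated], of _ M] coord_measurable_ip | simp)+
qed

lemma coord_gaussian_point: "coord (gaussian_point d \<omega> i) k = (if k < d then \<omega> (i, k) else 0)"
  unfolding gaussian_point_def coord_sum
  by (auto simp: lookup_single when_def)

lemma gaussian_point_in_coord_space: "gaussian_point d \<omega> i \<in> coord_space d"
  by (simp add: coord_space_def coord_gaussian_point)

lemma coord_measurable_gaussian_point:
  assumes "\<And>k. k < d \<Longrightarrow> (\<lambda>\<omega>. h \<omega> (i, k)) \<in> borel_measurable M"
  shows "coord_measurable M (\<lambda>\<omega>. gaussian_point d (h \<omega>) i)"
  unfolding coord_measurable_def
proof
  fix k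
  show "(\<lambda>\<omega>. coord (gaussian_point d (h \<omega>) i) k) \<in> borel_measurable M"
    using assms by (cases "k < d") (simp_all add: coord_gaussian_point)
qed

lemma coord_measurable_edge_normal:
  assumes B: "finite B" "B \<noteq> {}" and "\<And>i k. i \<in> B \<Longrightarrow> k < d \<Longrightarrow> (\<lambda>\<omega>. h \<omega> (i, k)) \<in> borel_measurable M"
  shows "coord_measurable M (\<lambda>\<omega>. unit_normal d (edge_list (gaussian_point d (h \<omega>)) B))"
proof -
  have "coord_measurable M (\<lambda>\<omega>. gaussian_point d (h \<omega>) i)" if "i \<in> B" for i
    using assms(3)[OF that] by (rule coord_measurable_gaussian_point)
  then show ?thesis
    unfolding edge_list_def using Min_in[OF B] B(1)
    by (intro coord_measurable_unit_normal coord_measurable_diff) auto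
qed

section \<open>The distance of a random hyperplane from the origin\<close>

abbreviation lborel_rows :: "(nat \<times> nat) set \<Rightarrow> (nat \<times> nat \<Rightarrow> real) measure" where
  "lborel_rows K \<equiv> PiM K (\<lambda>_. lborel)"

abbreviation normal_rows :: "real \<Rightarrow> (nat \<times> nat) set \<Rightarrow> (nat \<times> nat \<Rightarrow> real) measure" where
  "normal_rows s K \<equiv> PiM K (\<lambda>_. normal_dist s)"

lemma lborel_rows_component:
  "p \<in> K \<Longrightarrow> h \<in> measurable M (lborel_rows K) \<Longrightarrow> (\<lambda>\<omega>. h \<omega> p) \<in> borel_measurable M"
  using measurable_compose[OF _ measurable_component_singleton[of p K "\<lambda>_. lborel"], of h M] by simp

text \<open>
  The joint density of \<open>z\<close> and of the shifted variables \<open>y i + z\<close> factors into a function of \<open>y\<close> and a normal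
  density in \<open>z\<close> with variance \<open>1/r\<close>, centred at minus the sum of the \<open>y i\<close> divided by \<open>r\<close>. This is the
  independence of the mean and the differences of normal variables.
\<close>

lemma normal_density_complete_square:
  fixes y :: "'i \<Rightarrow> real" and z :: real
  assumes "finite I"
  defines "r \<equiv> real (Suc (card I))"
  defines "\<kappa> \<equiv> (1 / sqrt (2 * pi)) ^ Suc (card I) * sqrt (2 * pi / r) *
      exp (((\<Sum>i\<in>I. y i)\<^sup>2 / r - (\<Sum>i\<in>I. (y i)\<^sup>2)) / 2)"
  shows "std_normal_density z * (\<Prod>i\<in>I. std_normal_density (y i + z)) =
    \<kappa> * normal_density 0 (1 / sqrt r) (z + (\<Sum>i\<in>I. y i) / r)" and "0 \<le> \<kappa>"
proof -
  have r: "r > 0" by (simp add: r_def)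
  let ?S = "\<Sum>i\<in>I. y i" and ?Q = "\<Sum>i\<in>I. (y i)\<^sup>2"
  show "0 \<le> \<kappa>" using r by (auto simp: \<kappa>_def)
  have "std_normal_density z * (\<Prod>i\<in>I. std_normal_density (y i + z)) =
    (1 / sqrt (2 * pi)) ^ Suc (card I) * (exp (- z\<^sup>2 / 2) * (\<Prod>i\<in>I. exp (- (y i + z)\<^sup>2 / 2)))"
    by (simp add: std_normal_density_def prod.distrib prod_dividef power_one_over field_simps)
  also have "exp (- z\<^sup>2 / 2) * (\<Prod>i\<in>I. exp (- (y i + z)\<^sup>2 / 2)) =
      exp (- z\<^sup>2 / 2 + (\<Sum>i\<in>I. - (y i + z)\<^sup>2 / 2))"
    by (simp only: exp_add exp_sum[OF \<open>finite I\<close>])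
  also have "- z\<^sup>2 / 2 + (\<Sum>i\<in>I. - (y i + z)\<^sup>2 / 2) = (?S\<^sup>2 / r - ?Q) / 2 + - (r * (z + ?S / r)\<^sup>2 / 2)"
  proof -
    have "(\<Sum>i\<in>I. - (y i + z)\<^sup>2 / 2) = - (?Q + 2 * z * ?S + (r - 1) * z\<^sup>2) / 2"
    proof -
      have "- (y i + z)\<^sup>2 / 2 = (- 1 / 2) * (y i)\<^sup>2 + (- z) * y i + (- z\<^sup>2 / 2)" for i
        by (simp add: power2_eq_square field_simps)
      then have "(\<Sum>i\<in>I. - (y i + z)\<^sup>2 / 2) =
          (\<Sum>i\<in>I. (- 1 / 2) * (y i)\<^sup>2) + (\<Sum>i\<in>I. (- z) * y i) + (\<Sum>i\<in>I. - z\<^sup>2 / 2)"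
        by (simp only: sum.distrib)
      also have "\<dots> = (- 1 / 2) * ?Q + (- z) * ?S + real (card I) * (- z\<^sup>2 / 2)"
        by (simp only: sum_distrib_left[symmetric] sum_constant)
      finally show ?thesis by (simp add: r_def algebra_simps)
    qed
    moreover have "r * (z + ?S / r)\<^sup>2 = r * z\<^sup>2 + 2 * z * ?S + ?S\<^sup>2 / r"
      using r by (simp add: power2_eq_square field_simps)
    ultimately show ?thesis by (simp add: field_simps)
  qed
  also have "exp \<dots> = exp ((?S\<^sup>2 / r - ?Q) / 2) * exp (- (r * (z + ?S / r)\<^sup>2 / 2))"
    by (rule exp_add)
  also have "exp (- (r * (z + ?S / r)\<^sup>2 / 2)) = sqrt (2 * pi / r) * normal_density 0 (1 / sqrt r) (z + ?S / r)"
    using r by (simp add: normal_density_def power_divide real_sqrt_divide real_sqrt_mult field_simps)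
  finally show "std_normal_density z * (\<Prod>i\<in>I. std_normal_density (y i + z)) =
    \<kappa> * normal_density 0 (1 / sqrt r) (z + ?S / r)"
    by (simp only: \<kappa>_def mult_ac)
qed

text \<open>
  Let \<open>z\<close> be the base point and let \<open>y\<close> consist of the differences of the other \<open>d - 1\<close> points to \<open>z\<close>. In
  these variables the normal \<open>w\<close> depends on \<open>y\<close> alone and the signed distance is the inner product of
  \<open>w\<close> and \<open>z\<close>. For fixed \<open>y\<close> the density in \<open>z\<close> is a multiple of a product of normal densities with variance
  \<open>1/d\<close>, centred at a linear combination of the differences; this centre is orthogonal to \<open>w\<close>, so it does
  not shift the inner product, whose conditional law is then normal with variance \<open>1/d\<close> for every \<open>y\<close>.
  The remaining factor \<open>\<kappa>\<close> is not computed: the case of the constant function \<open>1\<close> shows that its total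
  integral is \<open>1\<close>.
\<close>

lemma nn_integral_signed_distance:
  fixes I :: "nat set" and G :: "real \<Rightarrow> ennreal"
  assumes d: "1 \<le> d" and card_I: "card I = d" and G[measurable]: "G \<in> borel_measurable borel"
  shows "(\<integral>\<^sup>+\<omega>. G (ip d (unit_normal d (edge_list (gaussian_point d \<omega>) I)) (gaussian_point d \<omega> (Min I)))
            \<partial>normal_rows 1 (I \<times> {..<d})) =
         (\<integral>\<^sup>+t. G t \<partial>normal_dist (1 / sqrt (real d)))"
proof -
  note lborel_rows_component[measurable (raw)]
  have fin: "finite I" and ne: "I \<noteq> {}" using card_I d card_gt_0_iff[of I] by auto
  define b where "b = Min I"
  have b: "b \<in> I" unfolding b_def using Min_in[OF fin ne] .
  define I' where "I' = I - {b}"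
  have fin': "finite I'" and card': "Suc (card I') = d" and bI': "b \<notin> I'" and I_eq: "I = insert b I'"
    using fin b card_I d by (auto simp: I'_def)
  define D where "D = {..<d}"
  have finD: "finite D" by (simp add: D_def)
  define K0 where "K0 = {b} \<times> D"
  define K1 where "K1 = I' \<times> D"
  have K: "I \<times> D = K0 \<union> K1" "K0 \<inter> K1 = {}" "finite K0" "finite K1"
    using bI' fin' finD by (auto simp: K0_def K1_def I_eq)
  define ns where "ns = sorted_list_of_set I'"
  have ns: "set ns = I'" "length ns < d" using fin' card' by (auto simp: ns_def)
  define w where "w y = unit_normal d (map (\<lambda>i. gaussian_point d y i) ns)" for y
  have w_norm: "(\<Sum>k\<in>D. (coord (w y) k)\<^sup>2) = 1" for y
    using unit_normal_norm[of "map (\<lambda>i. gaussian_point d y i) ns" d] ns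
    by (auto simp: w_def ip_def D_def power2_eq_square gaussian_point_in_coord_space image_subset_iff)
  have w_orth: "(\<Sum>k\<in>D. coord (w y) k * y (i, k)) = 0" if "i \<in> I'" for y i
    using unit_normal_orthogonal[of "map (\<lambda>i. gaussian_point d y i) ns" d "gaussian_point d y i"] ns that
    by (auto simp: w_def ip_def D_def coord_gaussian_point gaussian_point_in_coord_space image_subset_iff)
  have w_cm: "coord_measurable M (\<lambda>\<omega>. w (h \<omega>))" if "h \<in> measurable M (lborel_rows K1)" for M and h :: "'x \<Rightarrow> _"
    unfolding w_def
    by (intro coord_measurable_unit_normal coord_measurable_gaussian_point lborel_rows_component[OF _ that])
      (auto simp: K1_def D_def ns)
  have w_meas[measurable (raw)]: "(\<lambda>\<omega>. coord (w (h \<omega>)) k) \<in> borel_measurable M"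
    if "h \<in> measurable M (lborel_rows K1)" for M k and h :: "'x \<Rightarrow> _"
    by (rule coord_measurableD[OF w_cm[OF that]])
  define c where "c \<omega> = ip d (unit_normal d (edge_list (gaussian_point d \<omega>) I)) (gaussian_point d \<omega> b)" for \<omega>
  have c_meas[measurable (raw)]: "(\<lambda>\<omega>. c (h \<omega>)) \<in> borel_measurable M"
    if h: "h \<in> measurable M (lborel_rows (K0 \<union> K1))" for M and h :: "'x \<Rightarrow> _"
  proof -
    have comp: "(\<lambda>\<omega>. h \<omega> (i, k)) \<in> borel_measurable M" if "i \<in> I" "k < d" for i k
      by (rule lborel_rows_component[OF _ h]) (use that in \<open>auto simp: K(1)[symmetric] D_def\<close>)
    show ?thesis
      unfolding c_def
      by (intro coord_measurable_ip coord_measurable_edge_normal coord_measurable_gaussian_point comp fin ne b)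
  qed
  have c_shift: "c (merge K0 K1 (z, \<lambda>p\<in>K1. y p + z (b, snd p))) = (\<Sum>k\<in>D. coord (w y) k * z (b, k))" for y z
  proof -
    let ?m = "merge K0 K1 (z, \<lambda>p\<in>K1. y p + z (b, snd p))"
    have mb: "gaussian_point d ?m b = gaussian_point d z b"
      by (rule poly_mapping_eqI) (simp add: coord_gaussian_point merge_def K0_def D_def)
    have "gaussian_point d ?m i - gaussian_point d ?m b = gaussian_point d y i" if "i \<in> I'" for i
      using that bI' unfolding mb
      by (intro poly_mapping_eqI) (auto simp: coord_gaussian_point lookup_minus merge_def K0_def K1_def D_def)
    then have edges: "edge_list (gaussian_point d ?m) I = map (\<lambda>i. gaussian_point d y i) ns"
      using ns by (auto simp: edge_list_def ns_def I'_def b_def)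
    show ?thesis
      unfolding c_def mb edges by (simp add: w_def ip_def coord_gaussian_point D_def)
  qed
  define \<phi> :: "real \<Rightarrow> ennreal" where "\<phi> t = ennreal (std_normal_density t)" for t
  have [measurable]: "\<phi> \<in> borel_measurable borel" unfolding \<phi>_def by measurable
  \<comment> \<open>the integrand after the translation of the rows in \<open>K1\<close> by the base row\<close>
  define H where "H G' z y = (\<Prod>k\<in>D. \<phi> (z (b, k)) * (\<Prod>i\<in>I'. \<phi> (y (i, k) + z (b, k)))) *
      (G' (\<Sum>k\<in>D. coord (w y) k * z (b, k)) :: ennreal)" for G' and z y :: "nat \<times> nat \<Rightarrow> real"
  define \<kappa> where "\<kappa> y = (\<integral>\<^sup>+z. H (\<lambda>_. 1) z y \<partial>lborel_rows K0)" for y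
  have inK0: "(b, k) \<in> K0" if "k \<in> D" for k using that by (simp add: K0_def)
  have inK1: "(i, k) \<in> K1" if "i \<in> I'" "k \<in> D" for i k using that by (simp add: K1_def)
  have H_meas[measurable]: "(\<lambda>(z, y). H G' z y) \<in> borel_measurable (lborel_rows K0 \<Otimes>\<^sub>M lborel_rows K1)"
    if [measurable]: "G' \<in> borel_measurable borel" for G'
  proof -
    let ?M = "lborel_rows K0 \<Otimes>\<^sub>M lborel_rows K1"
    have z: "(\<lambda>x. fst x (b, k)) \<in> borel_measurable ?M" if "k \<in> D" for k
      by (rule lborel_rows_component[OF inK0[OF that] measurable_fst])
    have y: "(\<lambda>x. snd x (i, k)) \<in> borel_measurable ?M" if "i \<in> I'" "k \<in> D" for i k
      by (rule lborel_rows_component[OF inK1[OF that] measurable_snd])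
    have wm: "(\<lambda>x. coord (w (snd x)) k) \<in> borel_measurable ?M" for k
      by (rule w_meas[OF measurable_snd])
    have phi: "(\<lambda>x. \<phi> (f x)) \<in> borel_measurable ?M" if "f \<in> borel_measurable ?M" for f
      by (rule measurable_compose[OF that]) simp
    have "(\<lambda>x. G' (\<Sum>k\<in>D. coord (w (snd x)) k * fst x (b, k))) \<in> borel_measurable ?M"
      by (rule measurable_compose[OF _ that], rule borel_measurable_sum, rule borel_measurable_times[OF wm z])
    moreover have "(\<lambda>x. \<Prod>k\<in>D. \<phi> (fst x (b, k)) * (\<Prod>i\<in>I'. \<phi> (snd x (i, k) + fst x (b, k)))) \<in> borel_measurable ?M"
      by (rule borel_measurable_prod_ennreal, rule borel_measurable_times_ennreal, rule phi, erule z,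
          rule borel_measurable_prod_ennreal, rule phi, rule borel_measurable_add, erule (1) y, erule z)
    ultimately show ?thesis
      unfolding H_def split_beta' by (rule borel_measurable_times_ennreal[rotated])
  qed
  interpret L0: finite_product_sigma_finite "\<lambda>_. lborel :: real measure" K0 by standard (rule K)
  interpret L1: finite_product_sigma_finite "\<lambda>_. lborel :: real measure" K1 by standard (rule K)
  interpret P: pair_sigma_finite "lborel_rows K0" "lborel_rows K1" ..
  have main: "(\<integral>\<^sup>+\<omega>. G' (c \<omega>) \<partial>normal_rows 1 (I \<times> D)) = (\<integral>\<^sup>+y. \<integral>\<^sup>+z. H G' z y \<partial>lborel_rows K0 \<partial>lborel_rows K1)"
    if G'[measurable]: "G' \<in> borel_measurable borel" for G'
  proof -
    have cm: "c \<in> borel_measurable (lborel_rows (K0 \<union> K1))"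
      by (rule c_meas) simp
    have Gc: "(\<lambda>\<omega>. G' (c \<omega>)) \<in> borel_measurable (lborel_rows (K0 \<union> K1))"
      by (rule measurable_compose[OF cm G'])
    have phi: "(\<lambda>\<omega>. \<phi> (\<omega> p)) \<in> borel_measurable (lborel_rows (K0 \<union> K1))" if "p \<in> K0 \<union> K1" for p
      by (rule measurable_compose[OF measurable_component_singleton[OF that]]) simp
    have mF: "(\<lambda>\<omega>. (\<Prod>p\<in>K0 \<union> K1. \<phi> (\<omega> p)) * G' (c \<omega>)) \<in> borel_measurable (lborel_rows (K0 \<union> K1))"
      by (rule borel_measurable_times_ennreal[OF borel_measurable_prod_ennreal[OF phi] Gc])
    have "(\<integral>\<^sup>+\<omega>. G' (c \<omega>) \<partial>normal_rows 1 (I \<times> D)) =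
        (\<integral>\<^sup>+\<omega>. (\<Prod>p\<in>K0 \<union> K1. \<phi> (\<omega> p)) * G' (c \<omega>) \<partial>lborel_rows (K0 \<union> K1))"
      unfolding K(1) \<phi>_def by (rule nn_integral_PiM_normal) (use K Gc in auto)
    also have "\<dots> = (\<integral>\<^sup>+z. \<integral>\<^sup>+y. (\<Prod>p\<in>K0 \<union> K1. \<phi> (merge K0 K1 (z, y) p)) * G' (c (merge K0 K1 (z, y)))
        \<partial>lborel_rows K1 \<partial>lborel_rows K0)"
      by (rule L0.product_nn_integral_fold[OF K(2-4) mF])
    also have "\<dots> = (\<integral>\<^sup>+z. \<integral>\<^sup>+y. H G' z y \<partial>lborel_rows K1 \<partial>lborel_rows K0)"
    proof (rule nn_integral_cong)
      fix z assume z: "z \<in> space (lborel_rows K0)"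
      define F where "F y = (\<Prod>p\<in>K0 \<union> K1. \<phi> (merge K0 K1 (z, y) p)) * G' (c (merge K0 K1 (z, y)))" for y
      have mrg[measurable]: "(\<lambda>y. merge K0 K1 (z, y)) \<in> measurable (lborel_rows K1) (lborel_rows (K0 \<union> K1))"
        using z by measurable
      have F: "F \<in> borel_measurable (lborel_rows K1)"
        unfolding F_def by (rule measurable_compose[OF mrg mF])
      have "(\<integral>\<^sup>+y. F y \<partial>lborel_rows K1) = (\<integral>\<^sup>+y. F (\<lambda>p\<in>K1. y p + z (b, snd p)) \<partial>lborel_rows K1)"
        by (rule nn_integral_PiM_lborel_shift[OF K(4) F, symmetric])
      also have "\<dots> = (\<integral>\<^sup>+y. H G' z y \<partial>lborel_rows K1)"
      proof (rule nn_integral_cong)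
        fix y
        let ?m = "merge K0 K1 (z, \<lambda>p\<in>K1. y p + z (b, snd p))"
        have "(\<Prod>p\<in>K0 \<union> K1. \<phi> (?m p)) = (\<Prod>p\<in>K0. \<phi> (?m p)) * (\<Prod>p\<in>K1. \<phi> (?m p))"
          using K by (intro prod.union_disjoint) auto
        also have "(\<Prod>p\<in>K0. \<phi> (?m p)) = (\<Prod>k\<in>D. \<phi> (z (b, k)))"
        proof -
          have "K0 = Pair b ` D" by (auto simp: K0_def)
          then show ?thesis by (simp add: prod.reindex inj_on_def merge_def)
        qed
        also have "(\<Prod>p\<in>K1. \<phi> (?m p)) = (\<Prod>p\<in>K1. \<phi> (y p + z (b, snd p)))"
          using K by (intro prod.cong refl) (auto simp: merge_def)
        also have "\<dots> = (\<Prod>k\<in>D. \<Prod>i\<in>I'. \<phi> (y (i, k) + z (b, k)))"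
          unfolding K1_def by (subst prod.swap) (simp add: prod.cartesian_product split_beta')
        finally have phi_eq: "(\<Prod>p\<in>K0 \<union> K1. \<phi> (?m p)) =
          (\<Prod>k\<in>D. \<phi> (z (b, k))) * (\<Prod>k\<in>D. \<Prod>i\<in>I'. \<phi> (y (i, k) + z (b, k)))" .
        show "F (\<lambda>p\<in>K1. y p + z (b, snd p)) = H G' z y"
          unfolding F_def H_def c_shift phi_eq by (simp only: prod.distrib)
      qed
      finally show "(\<integral>\<^sup>+y. (\<Prod>p\<in>K0 \<union> K1. \<phi> (merge K0 K1 (z, y) p)) * G' (c (merge K0 K1 (z, y))) \<partial>lborel_rows K1) =
        (\<integral>\<^sup>+y. H G' z y \<partial>lborel_rows K1)" by (simp add: F_def)
    qed
    also have "\<dots> = (\<integral>\<^sup>+y. \<integral>\<^sup>+z. H G' z y \<partial>lborel_rows K0 \<partial>lborel_rows K1)"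
      by (rule P.Fubini'[symmetric]) (use H_meas[OF G'] in \<open>simp add: split_beta'\<close>)
    finally show ?thesis .
  qed
  define N where "N = (\<lambda>G'. \<integral>\<^sup>+t. G' t \<partial>normal_dist (1 / sqrt (real d)) :: ennreal)"
  have s: "0 < 1 / sqrt (real d)" using d by simp
  have inner: "\<exists>q. \<forall>G'\<in>borel_measurable borel. (\<integral>\<^sup>+z. H G' z y \<partial>lborel_rows K0) = q * N G'" for y
  proof -
    define m where "m k = (\<Sum>i\<in>I'. y (i, k)) / real d" for k
    define q where "q k = (1 / sqrt (2 * pi)) ^ Suc (card I') * sqrt (2 * pi / real (Suc (card I'))) *
      exp (((\<Sum>i\<in>I'. y (i, k))\<^sup>2 / real (Suc (card I')) - (\<Sum>i\<in>I'. (y (i, k))\<^sup>2)) / 2)" for k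
    have q0: "0 \<le> q k" for k by (auto simp: q_def)
    have sq: "\<phi> t * (\<Prod>i\<in>I'. \<phi> (y (i, k) + t)) = ennreal (q k) * ennreal (normal_density 0 (1 / sqrt (real d)) (t + m k))" for k t
    proof -
      have "\<phi> t * (\<Prod>i\<in>I'. \<phi> (y (i, k) + t)) = ennreal (std_normal_density t * (\<Prod>i\<in>I'. std_normal_density (y (i, k) + t)))"
        by (simp add: \<phi>_def prod_ennreal ennreal_mult prod_nonneg)
      then show ?thesis
        using normal_density_complete_square(1)[OF fin', of t "\<lambda>i. y (i, k)"] q0[of k]
        by (simp add: q_def m_def card' ennreal_mult)
    qed
    have w_m: "(\<Sum>k\<in>D. coord (w y) k * m k) = 0"
    proof -
      have "(\<Sum>k\<in>D. coord (w y) k * m k) = (\<Sum>k\<in>D. \<Sum>i\<in>I'. coord (w y) k * y (i, k)) / real d"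
        by (simp add: m_def sum_divide_distrib sum_distrib_left)
      also have "\<dots> = (\<Sum>i\<in>I'. \<Sum>k\<in>D. coord (w y) k * y (i, k)) / real d" by (subst sum.swap) simp
      also have "\<dots> = 0" by (simp add: w_orth)
      finally show ?thesis .
    qed
    have "(\<integral>\<^sup>+z. H G' z y \<partial>lborel_rows K0) = (\<Prod>k\<in>D. ennreal (q k)) * N G'"
      if G'[measurable]: "G' \<in> borel_measurable borel" for G'
    proof -
      define F where "F z = (\<Prod>p\<in>K0. ennreal (normal_density 0 (1 / sqrt (real d)) (z p))) *
          G' (\<Sum>p\<in>K0. coord (w y) (snd p) * z p)" for z :: "nat \<times> nat \<Rightarrow> real"
      have F[measurable]: "F \<in> borel_measurable (lborel_rows K0)"
        unfolding F_def by measurable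
      have K0_im: "K0 = Pair b ` D" by (auto simp: K0_def)
      have "(\<integral>\<^sup>+z. H G' z y \<partial>lborel_rows K0) =
          (\<integral>\<^sup>+z. (\<Prod>k\<in>D. ennreal (q k)) * F (\<lambda>p\<in>K0. z p + m (snd p)) \<partial>lborel_rows K0)"
      proof (rule nn_integral_cong)
        fix z :: "nat \<times> nat \<Rightarrow> real"
        have "(\<Sum>k\<in>D. coord (w y) k * (z (b, k) + m k)) = (\<Sum>k\<in>D. coord (w y) k * z (b, k))"
          using w_m by (simp add: distrib_left sum.distrib)
        then show "H G' z y = (\<Prod>k\<in>D. ennreal (q k)) * F (\<lambda>p\<in>K0. z p + m (snd p))"
          by (simp add: H_def F_def sq prod.distrib K0_im prod.reindex sum.reindex inj_on_def mult.assoc)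
      qed
      also have "\<dots> = (\<Prod>k\<in>D. ennreal (q k)) * (\<integral>\<^sup>+z. F (\<lambda>p\<in>K0. z p + m (snd p)) \<partial>lborel_rows K0)"
        by (rule nn_integral_cmult) measurable
      also have "(\<integral>\<^sup>+z. F (\<lambda>p\<in>K0. z p + m (snd p)) \<partial>lborel_rows K0) = (\<integral>\<^sup>+z. F z \<partial>lborel_rows K0)"
        by (rule nn_integral_PiM_lborel_shift[OF K(3) F])
      also have "\<dots> = (\<integral>\<^sup>+z. G' (\<Sum>p\<in>K0. coord (w y) (snd p) * z p) \<partial>normal_rows (1 / sqrt (real d)) K0)"
        unfolding F_def by (rule nn_integral_PiM_normal[OF K(3) s, symmetric]) measurable
      also have "\<dots> = N G'"
        unfolding N_def
        by (rule nn_integral_normal_linear[OF K(3) s _ G'])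
          (simp add: K0_im sum.reindex inj_on_def w_norm)
      finally show ?thesis .
    qed
    then show ?thesis by blast
  qed
  have N1: "N (\<lambda>_. 1) = 1"
    unfolding N_def using prob_space.emeasure_space_1[OF prob_space_normal_density[OF s, of 0]] by simp
  have \<kappa>_eq: "(\<integral>\<^sup>+z. H G' z y \<partial>lborel_rows K0) = \<kappa> y * N G'" if "G' \<in> borel_measurable borel" for G' y
  proof -
    obtain q where q: "\<And>G'. G' \<in> borel_measurable borel \<Longrightarrow> (\<integral>\<^sup>+z. H G' z y \<partial>lborel_rows K0) = q * N G'"
      using inner[of y] by blast
    have "\<kappa> y = q" unfolding \<kappa>_def using q[of "\<lambda>_. 1"] N1 by simp
    then show ?thesis using q[OF that] by simp
  qed
  have \<kappa>_meas: "\<kappa> \<in> borel_measurable (lborel_rows K1)"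
    unfolding \<kappa>_def
    by (rule L0.borel_measurable_nn_integral) (use H_meas[of "\<lambda>_. 1"] in \<open>simp add: split_beta' measurable_split_conv\<close>)
  have fact: "(\<integral>\<^sup>+\<omega>. G' (c \<omega>) \<partial>normal_rows 1 (I \<times> D)) = (\<integral>\<^sup>+y. \<kappa> y \<partial>lborel_rows K1) * N G'"
    if "G' \<in> borel_measurable borel" for G'
    unfolding main[OF that] \<kappa>_eq[OF that] by (rule nn_integral_multc[OF \<kappa>_meas])
  interpret NP: product_prob_space "\<lambda>_. normal_dist 1" "I \<times> D" by (rule product_prob_space_normal) simp
  have "(\<integral>\<^sup>+y. \<kappa> y \<partial>lborel_rows K1) = 1"
    using fact[of "\<lambda>_. 1"] N1 NP.P.emeasure_space_1 by simp
  then show ?thesis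
    using fact[OF G] by (simp add: c_def N_def b_def D_def)
qed

section \<open>The expected number of facets\<close>

lemma gaussian_array_eq: "gaussian_array n d = normal_rows 1 ({..<n} \<times> {..<d})"
  by (simp add: gaussian_array_def)

lemma normal_rows_component:
  "p \<in> K \<Longrightarrow> (\<lambda>\<omega>. \<omega> p) \<in> borel_measurable (normal_rows s K)"
  using measurable_component_singleton[of p K "\<lambda>_. normal_dist s"] by simp

text \<open>
  Conditioning on the rows in \<open>A\<close>: the direction \<open>V\<close> and the offset \<open>c\<close> are fixed by them, and the
  projections of the rows in \<open>J\<close> on the unit vector \<open>V\<close> are independent standard normal variables.
\<close>

lemma nn_integral_split_rows:
  fixes A J :: "nat set" and c :: "(nat \<times> nat \<Rightarrow> real) \<Rightarrow> real" and V :: "(nat \<times> nat \<Rightarrow> real) \<Rightarrow> nat \<Rightarrow> real"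
  assumes AJ: "finite A" "finite J" "A \<inter> J = {}" and D: "finite D"
    and dep: "\<And>\<omega> \<omega>'. (\<And>p. p \<in> A \<times> D \<Longrightarrow> \<omega> p = \<omega>' p) \<Longrightarrow> c \<omega> = c \<omega>' \<and> V \<omega> = V \<omega>'"
    and c: "c \<in> borel_measurable (normal_rows 1 ((A \<union> J) \<times> D))"
    and V: "\<And>k. k \<in> D \<Longrightarrow> (\<lambda>\<omega>. V \<omega> k) \<in> borel_measurable (normal_rows 1 ((A \<union> J) \<times> D))"
    and V_norm: "\<And>\<omega>. (\<Sum>k\<in>D. (V \<omega> k)\<^sup>2) = 1"
    and g: "(\<lambda>(a, t). g a t :: ennreal) \<in> borel_measurable (borel \<Otimes>\<^sub>M borel)"
  shows "(\<integral>\<^sup>+\<omega>. (\<Prod>j\<in>J. g (c \<omega>) (\<Sum>k\<in>D. V \<omega> k * \<omega> (j, k))) \<partial>normal_rows 1 ((A \<union> J) \<times> D)) =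
    (\<integral>\<^sup>+\<omega>. (\<integral>\<^sup>+t. g (c \<omega>) t \<partial>normal_dist 1) ^ card J \<partial>normal_rows 1 (A \<times> D))"
proof -
  interpret product_prob_space "\<lambda>_. normal_dist 1" "(A \<union> J) \<times> D" by (rule product_prob_space_normal) simp
  have dec: "(A \<union> J) \<times> D = A \<times> D \<union> J \<times> D" by auto
  let ?m = "merge (A \<times> D) (J \<times> D)"
  have meas: "(\<lambda>\<omega>. \<Prod>j\<in>J. g (c \<omega>) (\<Sum>k\<in>D. V \<omega> k * \<omega> (j, k))) \<in> borel_measurable (normal_rows 1 ((A \<union> J) \<times> D))"
  proof (rule borel_measurable_prod_ennreal)
    fix j assume "j \<in> J"
    then have "(\<lambda>\<omega>. \<Sum>k\<in>D. V \<omega> k * \<omega> (j, k)) \<in> borel_measurable (normal_rows 1 ((A \<union> J) \<times> D))"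
      by (intro borel_measurable_sum borel_measurable_times V normal_rows_component) auto
    from measurable_compose[OF measurable_Pair[OF c this] g]
    show "(\<lambda>\<omega>. g (c \<omega>) (\<Sum>k\<in>D. V \<omega> k * \<omega> (j, k))) \<in> borel_measurable (normal_rows 1 ((A \<union> J) \<times> D))"
      by simp
  qed
  have "(\<integral>\<^sup>+\<omega>. (\<Prod>j\<in>J. g (c \<omega>) (\<Sum>k\<in>D. V \<omega> k * \<omega> (j, k))) \<partial>normal_rows 1 ((A \<union> J) \<times> D)) =
    (\<integral>\<^sup>+x. \<integral>\<^sup>+y. (\<Prod>j\<in>J. g (c (?m (x, y))) (\<Sum>k\<in>D. V (?m (x, y)) k * ?m (x, y) (j, k)))
        \<partial>normal_rows 1 (J \<times> D) \<partial>normal_rows 1 (A \<times> D))"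
    unfolding dec by (rule product_nn_integral_fold) (use AJ D meas in \<open>auto simp: dec\<close>)
  also have "\<dots> = (\<integral>\<^sup>+x. \<integral>\<^sup>+y. (\<Prod>j\<in>J. g (c x) (\<Sum>k\<in>D. V x k * y (j, k)))
        \<partial>normal_rows 1 (J \<times> D) \<partial>normal_rows 1 (A \<times> D))"
  proof (intro nn_integral_cong prod.cong refl)
    fix x y :: "nat \<times> nat \<Rightarrow> real" and j assume j: "j \<in> J"
    have "c (?m (x, y)) = c x \<and> V (?m (x, y)) = V x"
      by (rule dep) (auto simp: merge_def)
    moreover have "(\<Sum>k\<in>D. V x k * ?m (x, y) (j, k)) = (\<Sum>k\<in>D. V x k * y (j, k))"
      using j AJ(3) by (intro sum.cong refl) (auto simp: merge_def)
    ultimately show "g (c (?m (x, y))) (\<Sum>k\<in>D. V (?m (x, y)) k * ?m (x, y) (j, k)) = g (c x) (\<Sum>k\<in>D. V x k * y (j, k))"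
      by simp
  qed
  also have "\<dots> = (\<integral>\<^sup>+\<omega>. (\<integral>\<^sup>+t. g (c \<omega>) t \<partial>normal_dist 1) ^ card J \<partial>normal_rows 1 (A \<times> D))"
  proof (intro nn_integral_cong nn_integral_normal_rows AJ D V_norm)
    fix x
    show "g (c x) \<in> borel_measurable borel"
      using measurable_compose[OF measurable_Pair1'[of "c x" borel borel] g] by simp
  qed simp
  finally show ?thesis .
qed

definition facet_normal :: "nat \<Rightarrow> (nat \<times> nat \<Rightarrow> real) \<Rightarrow> nat set \<Rightarrow> (nat \<Rightarrow>\<^sub>0 real)" where
  "facet_normal d \<omega> I = unit_normal d (edge_list (gaussian_point d \<omega>) I)"

definition facet_offset :: "nat \<Rightarrow> (nat \<times> nat \<Rightarrow> real) \<Rightarrow> nat set \<Rightarrow> real" where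
  "facet_offset d \<omega> I = ip d (facet_normal d \<omega> I) (gaussian_point d \<omega> (Min I))"

lemma side_gaussian_point:
  "side d (gaussian_point d \<omega>) I (gaussian_point d \<omega> j) =
    (\<Sum>k<d. coord (facet_normal d \<omega> I) k * \<omega> (j, k)) - facet_offset d \<omega> I"
  by (simp add: side_def facet_normal_def facet_offset_def ip_diff_right) (simp add: ip_def coord_gaussian_point)

lemma facet_normal_norm:
  "1 \<le> d \<Longrightarrow> card I = d \<Longrightarrow> (\<Sum>k<d. (coord (facet_normal d \<omega> I) k)\<^sup>2) = 1"
  using unit_normal_edge_list[of d I "gaussian_point d \<omega>"]
  by (simp add: facet_normal_def ip_def power2_eq_square gaussian_point_in_coord_space)

lemma facet_normal_measurable:
  assumes I: "finite I" "I \<noteq> {}" "I \<subseteq> A"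
  shows "coord_measurable (normal_rows s (A \<times> {..<d})) (\<lambda>\<omega>. facet_normal d \<omega> I)"
  unfolding facet_normal_def
  by (rule coord_measurable_edge_normal[OF I(1,2)], rule normal_rows_component) (use I in auto)

lemma facet_offset_measurable:
  assumes I: "finite I" "I \<noteq> {}" "I \<subseteq> A"
  shows "(\<lambda>\<omega>. facet_offset d \<omega> I) \<in> borel_measurable (normal_rows s (A \<times> {..<d}))"
proof -
  have "Min I \<in> A" using I(3) Min_in[OF I(1,2)] by (rule subsetD)
  then show ?thesis
    unfolding facet_offset_def
    by (intro coord_measurable_ip facet_normal_measurable[OF I] coord_measurable_gaussian_point normal_rows_component) auto
qed

lemma facet_normal_offset_cong:
  assumes I: "finite I" "I \<noteq> {}" "I \<subseteq> A" and eq: "\<And>p. p \<in> A \<times> {..<d} \<Longrightarrow> \<omega> p = \<omega>' p"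
  shows "facet_offset d \<omega> I = facet_offset d \<omega>' I \<and> coord (facet_normal d \<omega> I) = coord (facet_normal d \<omega>' I)"
proof -
  have gp: "gaussian_point d \<omega> i = gaussian_point d \<omega>' i" if "i \<in> I" for i
    by (rule poly_mapping_eqI) (use that I eq in \<open>auto simp: coord_gaussian_point\<close>)
  then have "edge_list (gaussian_point d \<omega>) I = edge_list (gaussian_point d \<omega>') I"
    using Min_in[OF I(1,2)] I(1) by (auto simp: edge_list_def)
  then show ?thesis
    using gp[OF Min_in[OF I(1,2)]] by (simp add: facet_normal_def facet_offset_def)
qed

lemma nn_integral_facet_rows:
  assumes d: "1 \<le> d" and I: "card I = d" "I \<subseteq> A" and AJ: "finite A" "finite J" "A \<inter> J = {}"
    and g: "(\<lambda>(a, t). g a t :: ennreal) \<in> borel_measurable (borel \<Otimes>\<^sub>M borel)"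
  shows "(\<integral>\<^sup>+\<omega>. (\<Prod>j\<in>J. g (facet_offset d \<omega> I) (\<Sum>k<d. coord (facet_normal d \<omega> I) k * \<omega> (j, k)))
        \<partial>normal_rows 1 ((A \<union> J) \<times> {..<d})) =
    (\<integral>\<^sup>+\<omega>. (\<integral>\<^sup>+t. g (facet_offset d \<omega> I) t \<partial>normal_dist 1) ^ card J \<partial>normal_rows 1 (A \<times> {..<d}))"
proof -
  have fin: "finite I" "I \<noteq> {}" using d I card_gt_0_iff[of I] by auto
  show ?thesis
  proof (rule nn_integral_split_rows[OF AJ _ _ _ _ _ g])
    show "(\<Sum>k<d. (coord (facet_normal d \<omega> I) k)\<^sup>2) = 1" for \<omega>
      by (rule facet_normal_norm[OF d I(1)])
    show "(\<lambda>\<omega>. facet_offset d \<omega> I) \<in> borel_measurable (normal_rows 1 ((A \<union> J) \<times> {..<d}))"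
      by (rule facet_offset_measurable) (use fin I in auto)
    show "(\<lambda>\<omega>. coord (facet_normal d \<omega> I) k) \<in> borel_measurable (normal_rows 1 ((A \<union> J) \<times> {..<d}))" for k
      by (rule coord_measurableD[OF facet_normal_measurable]) (use fin I in auto)
    show "facet_offset d \<omega> I = facet_offset d \<omega>' I \<and> coord (facet_normal d \<omega> I) = coord (facet_normal d \<omega>' I)"
      if "\<And>p. p \<in> A \<times> {..<d} \<Longrightarrow> \<omega> p = \<omega>' p" for \<omega> \<omega>'
      by (rule facet_normal_offset_cong[OF fin I(2) that])
  qed simp
qed

lemma emeasure_normal_singleton: "emeasure (normal_dist s) {c} = 0"
  by (subst emeasure_density) (auto simp: nn_integral_indicator_singleton)

lemma emeasure_normal_greaterThan: "emeasure (normal_dist 1) {c<..} = ennreal (normal_cdf (- c))"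
proof -
  have "{c<..} = UNIV - {..c}" by auto
  then show ?thesis
    using stdn.prob_compl[of "{..c}"] by (simp add: stdn.emeasure_eq_measure normal_cdf_minus normal_cdf_def[symmetric])
qed

lemma emeasure_normal_lessThan: "emeasure (normal_dist 1) {..<c} = ennreal (normal_cdf c)"
proof -
  have "emeasure (normal_dist 1) {..c} = emeasure (normal_dist 1) {..<c} + emeasure (normal_dist 1) {c}"
    by (subst plus_emeasure) (auto intro!: arg_cong[of _ _ "emeasure _"])
  then show ?thesis by (simp add: emeasure_normal_atMost emeasure_normal_singleton)
qed

text \<open>
  Given all the points except the \<open>j\<close>-th, the projection of the latter on the normal has no atoms.
\<close>

lemma AE_side_nonzero:
  assumes d: "1 \<le> d" and I: "card I = d" "I \<subseteq> {..<n}" and j: "j \<in> {..<n} - I"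
  shows "AE \<omega> in normal_rows 1 ({..<n} \<times> {..<d}). side d (gaussian_point d \<omega>) I (gaussian_point d \<omega> j) \<noteq> 0"
proof -
  let ?A = "{..<n} - {j}" and ?M = "normal_rows 1 ({..<n} \<times> {..<d})"
  let ?s = "\<lambda>\<omega>. \<Sum>k<d. coord (facet_normal d \<omega> I) k * \<omega> (j, k)"
  have un: "?A \<union> {j} = {..<n}" using j by auto
  have fin: "finite I" "I \<noteq> {}" using d I card_gt_0_iff[of I] by auto
  define g :: "real \<Rightarrow> real \<Rightarrow> ennreal" where "g c t = indicator {c} t" for c t
  have g: "(\<lambda>(a, t). g a t) \<in> borel_measurable (borel \<Otimes>\<^sub>M borel)"
    unfolding g_def indicator_def split_beta' singleton_iff by measurable
  have "(\<integral>\<^sup>+\<omega>. (\<Prod>j\<in>{j}. g (facet_offset d \<omega> I) (\<Sum>k<d. coord (facet_normal d \<omega> I) k * \<omega> (j, k))) \<partial>normal_rows 1 ((?A \<union> {j}) \<times> {..<d})) =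
    (\<integral>\<^sup>+\<omega>. (\<integral>\<^sup>+t. g (facet_offset d \<omega> I) t \<partial>normal_dist 1) ^ card {j} \<partial>normal_rows 1 (?A \<times> {..<d}))"
    by (rule nn_integral_facet_rows[OF d I(1) _ _ _ _ g]) (use I j in auto)
  also have "\<dots> = 0"
    by (simp add: g_def emeasure_normal_singleton)
  finally have 0: "(\<integral>\<^sup>+\<omega>. g (facet_offset d \<omega> I) (?s \<omega>) \<partial>?M) = 0"
    unfolding un by simp
  have s: "?s \<in> borel_measurable ?M"
    by (intro borel_measurable_sum borel_measurable_times coord_measurableD[OF facet_normal_measurable]
        normal_rows_component) (use fin I j in auto)
  have "(\<lambda>\<omega>. g (facet_offset d \<omega> I) (?s \<omega>)) \<in> borel_measurable ?M"
    using measurable_compose[OF measurable_Pair[OF facet_offset_measurable[OF fin I(2)] s] g] by simp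
  then have "AE \<omega> in ?M. g (facet_offset d \<omega> I) (?s \<omega>) = 0"
    using 0 by (simp add: nn_integral_0_iff_AE)
  then show ?thesis
    by eventually_elim (auto simp: side_gaussian_point g_def)
qed

text \<open>
  If no point is on the hyperplane through \<open>d\<close> others, then any \<open>d + 1\<close> points are affinely independent,
  because each of them is off a hyperplane that contains the rest. Hence the affine independence
  required of a facet is automatic, and a facet contains exactly \<open>d\<close> of the points.
\<close>

lemma facet_set_general_position:
  fixes x :: "nat \<Rightarrow> (nat \<Rightarrow>\<^sub>0 real)"
  assumes d: "1 \<le> d" and n: "d < n" and x: "\<And>i. x i \<in> coord_space d"
    and gen: "\<And>B j. B \<subseteq> {..<n} \<Longrightarrow> card B = d \<Longrightarrow> j \<in> {..<n} - B \<Longrightarrow> side d x B (x j) \<noteq> 0"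
    and I: "I \<subseteq> {..<n}"
  shows "facet_set d n x I \<longleftrightarrow> card I = d \<and>
    ((\<forall>j\<in>{..<n} - I. 0 < side d x I (x j)) \<or> (\<forall>j\<in>{..<n} - I. side d x I (x j) < 0))"
proof
  assume "facet_set d n x I"
  then obtain B where B: "B \<subseteq> I" "card B = d" "\<forall>i\<in>I. side d x B (x i) = 0"
    "(\<forall>j\<in>{..<n} - I. 0 < side d x B (x j)) \<or> (\<forall>j\<in>{..<n} - I. side d x B (x j) < 0)"
    unfolding facet_set_def by auto
  have "I = B"
  proof (rule ccontr)
    assume "I \<noteq> B"
    then obtain i where "i \<in> I - B" using B by auto
    then show False using gen[of B i] B I by auto
  qed
  then show "card I = d \<and>
    ((\<forall>j\<in>{..<n} - I. 0 < side d x I (x j)) \<or> (\<forall>j\<in>{..<n} - I. side d x I (x j) < 0))"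
    using B by auto
next
  assume *: "card I = d \<and>
    ((\<forall>j\<in>{..<n} - I. 0 < side d x I (x j)) \<or> (\<forall>j\<in>{..<n} - I. side d x I (x j) < 0))"
  then have card: "card I = d" ..
  have "I \<noteq> {..<n}" using card n by auto
  then obtain j where j: "j \<in> {..<n} - I" using I by auto
  define K where "K = insert j I"
  have K: "card K = Suc d" "K \<subseteq> {..<n}" "I \<subseteq> K"
    using card j I finite_subset[OF I] by (auto simp: K_def)
  have hull: "x i \<notin> affine hull (x ` (K - {i}))" if i: "i \<in> K" for i
  proof
    assume a: "x i \<in> affine hull (x ` (K - {i}))"
    have c: "card (K - {i}) = d" using K i by simp
    have "side d x (K - {i}) (x i) = 0" by (rule side_eq_0_of_affine_hull[OF d c x a])
    moreover have "side d x (K - {i}) (x i) \<noteq> 0" by (rule gen) (use K c i in auto)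
    ultimately show False by simp
  qed
  have inj: "inj_on x I"
  proof (rule inj_onI, rule ccontr)
    fix i i' assume i: "i \<in> I" "i' \<in> I" "x i = x i'" "i \<noteq> i'"
    then have "x i \<in> x ` (K - {i})" using K by auto
    then show False using hull[of i] i K hull_inc by (metis subsetD)
  qed
  have "\<not> affine_dependent (x ` I)"
    unfolding affine_dependent_def
  proof
    assume "\<exists>y\<in>x ` I. y \<in> affine hull (x ` I - {y})"
    then obtain i where i: "i \<in> I" "x i \<in> affine hull (x ` I - {x i})" by auto
    have "x ` I - {x i} \<subseteq> x ` (K - {i})" using K by auto
    then show False using hull[of i] i K hull_mono[of "x ` I - {x i}" "x ` (K - {i})" affine] by blast
  qed
  then have "indep_list d (edge_list x I)"
    using indep_edge_list_iff[OF d card x] inj by simp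
  moreover have "side d x I (x i) = 0" if "i \<in> I" for i
    by (rule side_eq_0_of_affine_hull[OF d card x]) (use that in \<open>auto intro: hull_inc\<close>)
  ultimately show "facet_set d n x I"
    unfolding facet_set_def using * by blast
qed

lemma AE_facet_set_iff:
  assumes d: "1 \<le> d" and n: "d < n"
  shows "AE \<omega> in normal_rows 1 ({..<n} \<times> {..<d}). \<forall>I\<in>Pow {..<n}. facet_set d n (gaussian_point d \<omega>) I \<longleftrightarrow>
    card I = d \<and> ((\<forall>j\<in>{..<n} - I. 0 < side d (gaussian_point d \<omega>) I (gaussian_point d \<omega> j)) \<or>
      (\<forall>j\<in>{..<n} - I. side d (gaussian_point d \<omega>) I (gaussian_point d \<omega> j) < 0))"
proof -
  let ?C = "{B \<in> Pow {..<n}. card B = d}"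
  have "AE \<omega> in normal_rows 1 ({..<n} \<times> {..<d}). \<forall>B\<in>?C. \<forall>j\<in>{..<n} - B.
      side d (gaussian_point d \<omega>) B (gaussian_point d \<omega> j) \<noteq> 0"
    by (intro AE_finite_allI) (use AE_side_nonzero[OF d] in auto)
  then show ?thesis
  proof eventually_elim
    case (elim \<omega>)
    then show ?case
      by (intro ballI facet_set_general_position[OF d n]) (auto simp: gaussian_point_in_coord_space)
  qed
qed

lemma indep_list_measurable:
  assumes "\<And>i. i \<in> set is \<Longrightarrow> coord_measurable M (f i)"
  shows "Measurable.pred M (\<lambda>\<omega>. indep_list d (map (\<lambda>i. f i \<omega>) is))"
  using assms
proof (induction "is")
  case (Cons i "is")
  have "coord_measurable M (\<lambda>\<omega>. orth_proj d (map (\<lambda>i. f i \<omega>) is) (f i \<omega>))"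
    by (rule coord_measurable_orth_proj) (use Cons.prems in auto)
  then have [measurable]: "(\<lambda>\<omega>. coord (orth_proj d (map (\<lambda>i. f i \<omega>) is) (f i \<omega>)) k) \<in> borel_measurable M" for k
    by (rule coord_measurableD)
  have IH[measurable]: "Measurable.pred M (\<lambda>\<omega>. indep_list d (map (\<lambda>i. f i \<omega>) is))"
    by (rule Cons.IH) (use Cons.prems in auto)
  have "v \<noteq> 0 \<longleftrightarrow> (\<exists>k. coord v k \<noteq> 0)" for v :: "nat \<Rightarrow>\<^sub>0 real"
    by (metis lookup_zero poly_mapping_eqI)
  then show ?case by simp
qed simp

lemma facet_set_measurable:
  assumes d: "1 \<le> d" and I: "I \<subseteq> {..<n}"
  shows "Measurable.pred (normal_rows s ({..<n} \<times> {..<d})) (\<lambda>\<omega>. facet_set d n (gaussian_point d \<omega>) I)"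
proof -
  let ?M = "normal_rows s ({..<n} \<times> {..<d})"
  have finI: "finite I" using I finite_subset by blast
  have gp: "coord_measurable ?M (\<lambda>\<omega>. gaussian_point d \<omega> i)" if "i < n" for i
    by (rule coord_measurable_gaussian_point, rule normal_rows_component) (use that in auto)
  have inner: "Measurable.pred ?M (\<lambda>\<omega>. card B = d \<and> indep_list d (edge_list (gaussian_point d \<omega>) B) \<and>
     (\<forall>i\<in>I. side d (gaussian_point d \<omega>) B (gaussian_point d \<omega> i) = 0) \<and>
     ((\<forall>j\<in>{..<n} - I. 0 < side d (gaussian_point d \<omega>) B (gaussian_point d \<omega> j)) \<or>
      (\<forall>j\<in>{..<n} - I. side d (gaussian_point d \<omega>) B (gaussian_point d \<omega> j) < 0)))"
    if "B \<in> Pow I" for B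
  proof (cases "card B = d")
    case True
    then have B: "finite B" "B \<noteq> {}" "B \<subseteq> {..<n}" using d card_gt_0_iff[of B] that I by auto
    have Min_B: "Min B < n" using subsetD[OF B(3) Min_in[OF B(1,2)]] by simp
    have ind: "Measurable.pred ?M (\<lambda>\<omega>. indep_list d (edge_list (gaussian_point d \<omega>) B))"
      unfolding edge_list_def using B Min_B
      by (intro indep_list_measurable coord_measurable_diff gp) auto
    let ?s = "\<lambda>\<omega> j. side d (gaussian_point d \<omega>) B (gaussian_point d \<omega> j)"
    have side: "(\<lambda>\<omega>. ?s \<omega> j) \<in> borel_measurable ?M" if "j < n" for j
      unfolding side_def using that B Min_B
      by (intro coord_measurable_ip coord_measurable_diff gp facet_normal_measurable[unfolded facet_normal_def]) auto
    have atoms: "Measurable.pred ?M (\<lambda>\<omega>. ?s \<omega> j = 0)" "Measurable.pred ?M (\<lambda>\<omega>. 0 < ?s \<omega> j)"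
      "Measurable.pred ?M (\<lambda>\<omega>. ?s \<omega> j < 0)" if "j < n" for j
      using side[OF that] by measurable
    have "Measurable.pred ?M (\<lambda>\<omega>. \<forall>i\<in>I. ?s \<omega> i = 0)"
      by (rule pred_intros_finite(3)[OF finI]) (use atoms I in auto)
    moreover have "Measurable.pred ?M (\<lambda>\<omega>. \<forall>j\<in>{..<n} - I. 0 < ?s \<omega> j)"
      by (rule pred_intros_finite(3)) (use atoms in auto)
    moreover have "Measurable.pred ?M (\<lambda>\<omega>. \<forall>j\<in>{..<n} - I. ?s \<omega> j < 0)"
      by (rule pred_intros_finite(3)) (use atoms in auto)
    ultimately show ?thesis
      using True by (simp only: simp_thms) (intro pred_intros_logic ind)
  qed simp
  show ?thesis
    unfolding facet_set_def by (rule pred_intros_finite(4)[OF _ inner]) (use finI in simp_all)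
qed

lemma normal_cdf_measurable[measurable]: "normal_cdf \<in> borel_measurable borel"
  by (rule borel_measurable_continuous_onI)
    (auto intro!: continuous_at_imp_continuous_on DERIV_isCont[OF normal_cdf_deriv])

text \<open>
  The events that all the other points are on the positive side and that all are on the negative side
  exclude each other. They are equally likely because the law of the signed distance is symmetric.
\<close>

lemma emeasure_same_side:
  assumes d: "1 \<le> d" and n: "d < n" and I: "I \<subseteq> {..<n}" "card I = d"
  defines "M \<equiv> normal_rows 1 ({..<n} \<times> {..<d})"
  shows "emeasure M {\<omega> \<in> space M.
      (\<forall>j\<in>{..<n} - I. 0 < side d (gaussian_point d \<omega>) I (gaussian_point d \<omega> j)) \<or>
      (\<forall>j\<in>{..<n} - I. side d (gaussian_point d \<omega>) I (gaussian_point d \<omega> j) < 0)} =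
    2 * (\<integral>\<^sup>+t. ennreal (normal_cdf t) ^ (n - d) \<partial>normal_dist (1 / sqrt (real d)))"
proof -
  define J where "J = {..<n} - I"
  have fin: "finite I" "I \<noteq> {}" using d I card_gt_0_iff[of I] by auto
  have J: "finite J" "I \<inter> J = {}" "I \<union> J = {..<n}" "card J = n - d"
    using I(1) card_Diff_subset[OF fin(1) I(1)] I(2) by (auto simp: J_def)
  have "J \<noteq> {}"
  proof
    assume "J = {}"
    then show False using J(4) n by simp
  qed
  let ?s = "\<lambda>\<omega> j. \<Sum>k<d. coord (facet_normal d \<omega> I) k * \<omega> (j, k)"
  have s: "(\<lambda>\<omega>. ?s \<omega> j) \<in> borel_measurable M" if "j \<in> J" for j
    unfolding M_def
    by (intro borel_measurable_sum borel_measurable_times coord_measurableD[OF facet_normal_measurable]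
        normal_rows_component) (use fin I that in \<open>auto simp: J_def\<close>)
  have c: "(\<lambda>\<omega>. facet_offset d \<omega> I) \<in> borel_measurable M"
    unfolding M_def by (rule facet_offset_measurable[OF fin I(1)])
  have gen: "emeasure M {\<omega> \<in> space M. \<forall>j\<in>J. ?s \<omega> j \<in> S (facet_offset d \<omega> I)} =
      (\<integral>\<^sup>+t. emeasure (normal_dist 1) (S t) ^ (n - d) \<partial>normal_dist (1 / sqrt (real d)))"
    and meas: "{\<omega> \<in> space M. \<forall>j\<in>J. ?s \<omega> j \<in> S (facet_offset d \<omega> I)} \<in> sets M"
    if S: "{(a, t). t \<in> S a} \<in> sets (borel \<Otimes>\<^sub>M borel)" and S': "\<And>a. S a \<in> sets borel"
      and Q: "(\<lambda>a. emeasure (normal_dist 1) (S a)) \<in> borel_measurable borel" for S :: "real \<Rightarrow> real set"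
  proof -
    define g :: "real \<Rightarrow> real \<Rightarrow> ennreal" where "g a t = indicator (S a) t" for a t
    have "(\<lambda>(a, t). g a t) = indicator {(a, t). t \<in> S a}"
      by (auto simp: g_def indicator_def fun_eq_iff)
    then have g: "(\<lambda>(a, t). g a t) \<in> borel_measurable (borel \<Otimes>\<^sub>M borel)"
      using S by simp
    have "{\<omega> \<in> space M. ?s \<omega> j \<in> S (facet_offset d \<omega> I)} \<in> sets M" if "j \<in> J" for j
      using measurable_sets[OF measurable_Pair[OF c s[OF that]] S]
      by (simp add: vimage_def Int_def conj_commute case_prod_beta')
    then show m: "{\<omega> \<in> space M. \<forall>j\<in>J. ?s \<omega> j \<in> S (facet_offset d \<omega> I)} \<in> sets M"
      using J by (intro sets.sets_Collect_finite_All') (use \<open>J \<noteq> {}\<close> in auto)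
    have "emeasure M {\<omega> \<in> space M. \<forall>j\<in>J. ?s \<omega> j \<in> S (facet_offset d \<omega> I)} =
        (\<integral>\<^sup>+\<omega>. indicator {\<omega> \<in> space M. \<forall>j\<in>J. ?s \<omega> j \<in> S (facet_offset d \<omega> I)} \<omega> \<partial>M)"
      using m by simp
    also have "\<dots> = (\<integral>\<^sup>+\<omega>. (\<Prod>j\<in>J. g (facet_offset d \<omega> I) (?s \<omega> j)) \<partial>M)"
      by (intro nn_integral_cong) (auto simp: g_def indicator_def prod_zero_iff J(1))
    also have "\<dots> = (\<integral>\<^sup>+\<omega>. (\<integral>\<^sup>+t. g (facet_offset d \<omega> I) t \<partial>normal_dist 1) ^ card J \<partial>normal_rows 1 (I \<times> {..<d}))"
      unfolding M_def J(3)[symmetric] by (rule nn_integral_facet_rows[OF d I(2) order_refl fin(1) J(1,2) g])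
    also have "\<dots> = (\<integral>\<^sup>+\<omega>. emeasure (normal_dist 1) (S (facet_offset d \<omega> I)) ^ (n - d) \<partial>normal_rows 1 (I \<times> {..<d}))"
      using S' by (simp add: g_def J(4))
    also have "\<dots> = (\<integral>\<^sup>+t. emeasure (normal_dist 1) (S t) ^ (n - d) \<partial>normal_dist (1 / sqrt (real d)))"
      unfolding facet_offset_def facet_normal_def
      by (rule nn_integral_signed_distance[OF d I(2), of "\<lambda>a. emeasure (normal_dist 1) (S a) ^ (n - d)"])
        (intro borel_measurable_power_ennreal Q)
    finally show "emeasure M {\<omega> \<in> space M. \<forall>j\<in>J. ?s \<omega> j \<in> S (facet_offset d \<omega> I)} =
      (\<integral>\<^sup>+t. emeasure (normal_dist 1) (S t) ^ (n - d) \<partial>normal_dist (1 / sqrt (real d)))" .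
  qed
  have S1: "{(a :: real, t). t \<in> {a<..}} \<in> sets (borel \<Otimes>\<^sub>M borel)"
   and S2: "{(a :: real, t). t \<in> {..<a}} \<in> sets (borel \<Otimes>\<^sub>M borel)"
  proof -
    have "{x \<in> space (borel \<Otimes>\<^sub>M borel). fst x < (snd x :: real)} \<in> sets (borel \<Otimes>\<^sub>M borel)" by measurable
    then show "{(a :: real, t). t \<in> {a<..}} \<in> sets (borel \<Otimes>\<^sub>M borel)"
      by (simp add: split_beta' space_pair_measure)
    have "{x \<in> space (borel \<Otimes>\<^sub>M borel). snd x < (fst x :: real)} \<in> sets (borel \<Otimes>\<^sub>M borel)" by measurable
    then show "{(a :: real, t). t \<in> {..<a}} \<in> sets (borel \<Otimes>\<^sub>M borel)"
      by (simp add: split_beta' space_pair_measure)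
  qed
  let ?Q = "\<integral>\<^sup>+t. ennreal (normal_cdf t) ^ (n - d) \<partial>normal_dist (1 / sqrt (real d))"
  let ?Ep = "{\<omega> \<in> space M. \<forall>j\<in>J. ?s \<omega> j \<in> {facet_offset d \<omega> I<..}}"
  let ?Em = "{\<omega> \<in> space M. \<forall>j\<in>J. ?s \<omega> j \<in> {..<facet_offset d \<omega> I}}"
  have "emeasure M ?Ep = (\<integral>\<^sup>+t. ennreal (normal_cdf (- t)) ^ (n - d) \<partial>normal_dist (1 / sqrt (real d)))"
    using gen[OF S1] by (simp add: emeasure_normal_greaterThan)
  also have "\<dots> = ?Q"
    by (rule nn_integral_normal_reflect[of "\<lambda>t. ennreal (normal_cdf t) ^ (n - d)"]) measurable
  finally have Ep: "emeasure M ?Ep = ?Q" .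
  have Em: "emeasure M ?Em = ?Q"
    using gen[OF S2] by (simp add: emeasure_normal_lessThan)
  have eq: "{\<omega> \<in> space M.
      (\<forall>j\<in>{..<n} - I. 0 < side d (gaussian_point d \<omega>) I (gaussian_point d \<omega> j)) \<or>
      (\<forall>j\<in>{..<n} - I. side d (gaussian_point d \<omega>) I (gaussian_point d \<omega> j) < 0)} = ?Ep \<union> ?Em"
    by (auto simp: side_gaussian_point J_def)
  have un: "emeasure M (?Ep \<union> ?Em) = emeasure M ?Ep + emeasure M ?Em"
  proof (rule plus_emeasure[symmetric])
    show "?Ep \<in> sets M" by (rule meas[OF S1]) (simp_all add: emeasure_normal_greaterThan)
    show "?Em \<in> sets M" by (rule meas[OF S2]) (simp_all add: emeasure_normal_lessThan)
    show "?Ep \<inter> ?Em = {}" using \<open>J \<noteq> {}\<close> by force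
  qed
  show ?thesis unfolding eq un Ep Em by (rule mult_2[symmetric])
qed

theorem expected_num_facets:
  assumes d: "1 \<le> d" and n: "d < n"
  shows "expected_num_faces (d - 1) n d = 2 * real (n choose d) *
    enn2real (\<integral>\<^sup>+t. ennreal (normal_cdf t) ^ (n - d) \<partial>normal_dist (1 / sqrt (real d)))"
proof -
  let ?M = "normal_rows 1 ({..<n} \<times> {..<d})"
  let ?Q = "\<integral>\<^sup>+t. ennreal (normal_cdf t) ^ (n - d) \<partial>normal_dist (1 / sqrt (real d))"
  let ?F = "\<lambda>I \<omega>. facet_set d n (gaussian_point d \<omega>) I"
  have faces: "real (num_faces (d - 1) (gaussian_polytope n d \<omega>)) = (\<Sum>I\<in>Pow {..<n}. indicator {\<omega>. ?F I \<omega>} \<omega>)" for \<omega>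
  proof -
    have "num_faces (d - 1) (gaussian_polytope n d \<omega>) = card {I \<in> Pow {..<n}. ?F I \<omega>}"
      unfolding gaussian_polytope_def
      by (rule num_faces_eq_card_facet_sets[OF d gaussian_point_in_coord_space])
    then show ?thesis
      by (simp add: indicator_def sum.If_cases Int_def)
  qed
  have F[measurable]: "Measurable.pred ?M (?F I)" if "I \<in> Pow {..<n}" for I
    using facet_set_measurable[OF d, of I n 1] that by simp
  have sets: "{\<omega> \<in> space ?M. ?F I \<omega>} \<in> sets ?M" if "I \<in> Pow {..<n}" for I
    using F[OF that] by measurable
  have ind: "(indicator {\<omega>. ?F I \<omega>} :: _ \<Rightarrow> real) \<in> borel_measurable ?M" if "I \<in> Pow {..<n}" for I
    using F[OF that] by measurable
  have prob: "emeasure ?M {\<omega> \<in> space ?M. ?F I \<omega>} = (if card I = d then 2 * ?Q else 0)" if I: "I \<in> Pow {..<n}" for I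
  proof -
    let ?E = "{\<omega> \<in> space ?M. card I = d \<and> ((\<forall>j\<in>{..<n} - I. 0 < side d (gaussian_point d \<omega>) I (gaussian_point d \<omega> j)) \<or>
      (\<forall>j\<in>{..<n} - I. side d (gaussian_point d \<omega>) I (gaussian_point d \<omega> j) < 0))}"
    have E: "?E \<in> sets ?M"
    proof (cases "card I = d")
      case True
      have fin: "finite I" "I \<noteq> {}" using d True card_gt_0_iff[of I] by auto
      have Min_I: "Min I < n" using subsetD[OF _ Min_in[OF fin], of "{..<n}"] I by simp
      have gp: "coord_measurable ?M (\<lambda>\<omega>. gaussian_point d \<omega> i)" if "i < n" for i
        by (rule coord_measurable_gaussian_point, rule normal_rows_component) (use that in auto)
      have [measurable]: "(\<lambda>\<omega>. side d (gaussian_point d \<omega>) I (gaussian_point d \<omega> j)) \<in> borel_measurable ?M"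
        if "j \<in> {..<n} - I" for j
        unfolding side_def using that I fin Min_I
        by (intro coord_measurable_ip coord_measurable_diff gp facet_normal_measurable[unfolded facet_normal_def]) auto
      show ?thesis by measurable
    qed simp
    have "emeasure ?M {\<omega> \<in> space ?M. ?F I \<omega>} = emeasure ?M ?E"
    proof (rule emeasure_eq_AE[OF _ sets[OF I] E])
      show "AE \<omega> in ?M. \<omega> \<in> {\<omega> \<in> space ?M. ?F I \<omega>} \<longleftrightarrow> \<omega> \<in> ?E"
        using AE_facet_set_iff[OF d n] by eventually_elim (use I in auto)
    qed
    also have "\<dots> = (if card I = d then 2 * ?Q else 0)"
      using emeasure_same_side[OF d n, of I] I by simp
    finally show ?thesis .
  qed
  have "expected_num_faces (d - 1) n d = (\<integral>\<omega>. (\<Sum>I\<in>Pow {..<n}. indicator {\<omega>. ?F I \<omega>} \<omega>) \<partial>?M)"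
    unfolding expected_num_faces_def gaussian_array_eq faces ..
  also have "\<dots> = enn2real (\<integral>\<^sup>+\<omega>. ennreal (\<Sum>I\<in>Pow {..<n}. indicator {\<omega>. ?F I \<omega>} \<omega>) \<partial>?M)"
    by (rule integral_eq_nn_integral) (auto intro!: borel_measurable_sum ind sum_nonneg)
  also have "(\<integral>\<^sup>+\<omega>. ennreal (\<Sum>I\<in>Pow {..<n}. indicator {\<omega>. ?F I \<omega>} \<omega>) \<partial>?M) =
      (\<integral>\<^sup>+\<omega>. (\<Sum>I\<in>Pow {..<n}. indicator {\<omega> \<in> space ?M. ?F I \<omega>} \<omega>) \<partial>?M)"
    by (intro nn_integral_cong) (simp add: indicator_def sum.If_cases ennreal_of_nat_eq_real_of_nat)
  also have "\<dots> = (\<Sum>I\<in>Pow {..<n}. \<integral>\<^sup>+\<omega>. indicator {\<omega> \<in> space ?M. ?F I \<omega>} \<omega> \<partial>?M)"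
    by (intro nn_integral_sum borel_measurable_indicator sets)
  also have "\<dots> = (\<Sum>I\<in>Pow {..<n}. if card I = d then 2 * ?Q else 0)"
    using prob sets by (intro sum.cong) simp_all
  also have "\<dots> = of_nat (n choose d) * (2 * ?Q)"
  proof -
    have "card {I \<in> Pow {..<n}. card I = d} = n choose d"
      using n_subsets[of "{..<n}" d] by (simp add: Pow_def)
    then show ?thesis by (simp add: sum.If_cases Int_def)
  qed
  also have "enn2real \<dots> = 2 * real (n choose d) * enn2real ?Q"
    by (simp add: enn2real_mult)
  finally show ?thesis .
qed

section \<open>The asymptotic formula\<close>

lemma expected_num_facets_bounds:
  assumes d: "1 \<le> d" and n: "d < n"
  defines "m \<equiv> real n - real d"
  obtains T where
    "expected_num_faces (d - 1) n d = real (n choose d) * 2 powr (- m + 1) * exp (1 / pi * (m\<^sup>2 / real d) + T)"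
    "- (1 / pi * (m ^ 3 / (real d)\<^sup>2)) - m / real d / 2 \<le> T" "T \<le> 0"
proof -
  define J where "J = (\<integral>\<^sup>+t. ennreal ((2 * normal_cdf t) ^ (n - d)) \<partial>normal_dist (1 / sqrt (real d)))"
  have m: "m = real (n - d)" using n by (simp add: m_def of_nat_diff)
  let ?lo = "exp (m ^ 2 / (pi * real d) - m ^ 3 / (pi * real d ^ 2) - m / (2 * real d))"
  let ?hi = "exp (m ^ 2 / (pi * real d))"
  have J: "ennreal ?lo \<le> J" "J \<le> ennreal ?hi"
    using nn_integral_normal_cdf_power_bounds[OF d, of "n - d"] by (simp_all add: J_def m)
  define j where "j = enn2real J"
  have "J < \<top>" using J(2) ennreal_less_top le_less_trans by blast
  then have Jj: "J = ennreal j" by (simp add: j_def)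
  have j: "?lo \<le> j" "j \<le> ?hi"
  proof -
    have "0 \<le> j" by (simp add: j_def)
    then show "?lo \<le> j" "j \<le> ?hi" using J by (simp_all add: Jj)
  qed
  have j0: "0 < j" using j(1) exp_gt_zero less_le_trans by blast
  have "(\<integral>\<^sup>+t. ennreal (normal_cdf t) ^ (n - d) \<partial>normal_dist (1 / sqrt (real d))) =
      (\<integral>\<^sup>+t. ennreal ((1 / 2) ^ (n - d)) * ennreal ((2 * normal_cdf t) ^ (n - d)) \<partial>normal_dist (1 / sqrt (real d)))"
  proof (intro nn_integral_cong)
    fix t
    have "(1 / 2) ^ (n - d) * (2 * normal_cdf t) ^ (n - d) = normal_cdf t ^ (n - d)"
      by (simp only: power_mult_distrib[symmetric]) simp
    then show "ennreal (normal_cdf t) ^ (n - d) = ennreal ((1 / 2) ^ (n - d)) * ennreal ((2 * normal_cdf t) ^ (n - d))"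
      by (simp add: ennreal_power normal_cdf_nonneg ennreal_mult'[symmetric])
  qed
  also have "\<dots> = ennreal ((1 / 2) ^ (n - d)) * J"
    unfolding J_def by (rule nn_integral_cmult) measurable
  also have "\<dots> = ennreal ((1 / 2) ^ (n - d) * j)"
    using j0 by (simp add: Jj ennreal_mult)
  finally have faces: "expected_num_faces (d - 1) n d = 2 * real (n choose d) * ((1 / 2) ^ (n - d) * j)"
    using expected_num_facets[OF d n] j0 by simp
  have pow: "2 powr (- m + 1) = 2 * (1 / 2) ^ (n - d)"
  proof -
    have "2 powr (- m + 1) = 2 powr (- m) * (2 powr 1 :: real)" by (rule powr_add)
    also have "2 powr (- m) = (1 / 2 :: real) ^ (n - d)"
      by (simp add: m powr_minus powr_realpow power_one_over inverse_eq_divide)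
    finally show ?thesis by simp
  qed
  define T where "T = ln j - 1 / pi * (m\<^sup>2 / real d)"
  have exp_T: "j = exp (1 / pi * (m\<^sup>2 / real d) + T)" using j0 by (simp add: T_def)
  have "expected_num_faces (d - 1) n d =
      real (n choose d) * 2 powr (- m + 1) * exp (1 / pi * (m\<^sup>2 / real d) + T)"
    unfolding faces pow exp_T[symmetric] by simp
  moreover have "ln ?lo \<le> ln j" "ln j \<le> ln ?hi"
    using j j0 by (simp_all only: ln_le_cancel_iff exp_gt_zero)
  then have "- (1 / pi * (m ^ 3 / (real d)\<^sup>2)) - m / real d / 2 \<le> T" "T \<le> 0"
    by (simp_all add: T_def mult.commute)
  ultimately show ?thesis using that by blast
qed

theorem theorem1p3:
  shows "\<exists>C::real. C > 0 \<and>
    (\<forall>n :: nat \<Rightarrow> nat.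
      (\<forall>d\<ge>1. n d \<ge> d + 1) \<longrightarrow>
      (\<lambda>d. (real (n d) - real d) / real d) \<longlonglongrightarrow> 0 \<longrightarrow>
      (\<exists>(R :: nat \<Rightarrow> real) (\<epsilon> :: nat \<Rightarrow> real).
        (\<forall>d\<ge>1. \<bar>R d\<bar> \<le> C * ((real (n d) - real d) ^ 3 / (real d)\<^sup>2)) \<and>
        \<epsilon> \<longlonglongrightarrow> 0 \<and>
        (\<forall>\<^sub>F d in sequentially.
          expected_num_faces (d - 1) (n d) d =
            real (n d choose d) * 2 powr (- (real (n d) - real d) + 1) *
            exp (1 / pi * ((real (n d) - real d)\<^sup>2 / real d) + R d + \<epsilon> d))))"
proof (intro exI[of _ "1 / pi"] conjI allI impI)
  fix n :: "nat \<Rightarrow> nat"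
  assume n: "\<forall>d\<ge>1. n d \<ge> d + 1" and lim: "(\<lambda>d. (real (n d) - real d) / real d) \<longlonglongrightarrow> 0"
  define m where "m d = real (n d) - real d" for d
  define B where "B d = 1 / pi * (m d ^ 3 / (real d)\<^sup>2)" for d
  have "\<exists>T. expected_num_faces (d - 1) (n d) d =
        real (n d choose d) * 2 powr (- m d + 1) * exp (1 / pi * ((m d)\<^sup>2 / real d) + T) \<and>
      - B d - m d / real d / 2 \<le> T \<and> T \<le> 0" if "1 \<le> d" for d
    using expected_num_facets_bounds[of d "n d"] n that unfolding m_def B_def
    by (metis Suc_eq_plus1 Suc_le_lessD)
  then obtain T where T: "\<And>d. 1 \<le> d \<Longrightarrow> expected_num_faces (d - 1) (n d) d =
        real (n d choose d) * 2 powr (- m d + 1) * exp (1 / pi * ((m d)\<^sup>2 / real d) + T d)"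
      "\<And>d. 1 \<le> d \<Longrightarrow> - B d - m d / real d / 2 \<le> T d" "\<And>d. 1 \<le> d \<Longrightarrow> T d \<le> 0"
    by metis
  have B: "0 \<le> B d" if "1 \<le> d" for d
    using n that by (auto simp: B_def m_def intro!: mult_nonneg_nonneg)
  \<comment> \<open>\<open>T\<close> is truncated at \<open>- B\<close>; the overshoot is at most \<open>m / (2 d)\<close> and goes into \<open>\<epsilon>\<close>\<close>
  define R where "R d = max (T d) (- B d)" for d
  define \<epsilon> where "\<epsilon> d = T d - R d" for d
  show "\<exists>(R :: nat \<Rightarrow> real) (\<epsilon> :: nat \<Rightarrow> real).
        (\<forall>d\<ge>1. \<bar>R d\<bar> \<le> 1 / pi * ((real (n d) - real d) ^ 3 / (real d)\<^sup>2)) \<and>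
        \<epsilon> \<longlonglongrightarrow> 0 \<and>
        (\<forall>\<^sub>F d in sequentially.
          expected_num_faces (d - 1) (n d) d =
            real (n d choose d) * 2 powr (- (real (n d) - real d) + 1) *
            exp (1 / pi * ((real (n d) - real d)\<^sup>2 / real d) + R d + \<epsilon> d))"
  proof (intro exI conjI allI impI)
    show "\<bar>R d\<bar> \<le> 1 / pi * ((real (n d) - real d) ^ 3 / (real d)\<^sup>2)" if "1 \<le> d" for d
      using T(3)[OF that] B[OF that] by (auto simp: R_def B_def m_def)
    have \<epsilon>: "\<bar>\<epsilon> d\<bar> \<le> m d / real d / 2" if "1 \<le> d" for d
    proof -
      have "0 \<le> m d / real d / 2" using n that by (auto simp: m_def)
      then show ?thesis using T(2)[OF that] by (auto simp: \<epsilon>_def R_def)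
    qed
    have "\<forall>\<^sub>F d in sequentially. norm (\<epsilon> d) \<le> m d / real d / 2"
      using eventually_ge_at_top[of 1] by eventually_elim (use \<epsilon> in \<open>simp only: real_norm_def\<close>)
    moreover have "(\<lambda>d. m d / real d / 2) \<longlonglongrightarrow> 0"
      using tendsto_divide[OF lim tendsto_const, of 2] by (simp add: m_def)
    ultimately show "\<epsilon> \<longlonglongrightarrow> 0" by (rule Lim_null_comparison)
    show "\<forall>\<^sub>F d in sequentially.
          expected_num_faces (d - 1) (n d) d =
            real (n d choose d) * 2 powr (- (real (n d) - real d) + 1) *
            exp (1 / pi * ((real (n d) - real d)\<^sup>2 / real d) + R d + \<epsilon> d)"
      using eventually_ge_at_top[of 1]
    proof eventually_elim
      case (elim d)
      show ?case using T(1)[OF elim] by (simp add: \<epsilon>_def m_def add.assoc)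
    qed
  qed
qed simp

end
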